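(* Let $\mathcal{H}$ and $\mathcal{G}$ be real Hilbert spaces, $f:\mathcal{H}\to\overline{\mathbb{R}}$ and $g:\mathcal{G}\to\overline{\mathbb{R}}$ proper, convex and lower semicontinuous functions, $h:\mathcal{H}\to\mathbb{R}$ a convex and Fréchet differentiable function with $L$-Lipschitz continuous gradient (where $L\ge 0$), and $A:\mathcal{H}\to\mathcal{G}$ a linear continuous operator. Assume that the set of saddle points of the Lagrangian $l(x,z,y)=f(x)+h(x)+g(z)+\langle y,Ax-z\rangle$ is nonempty. Let $c>0$, let $M_1^k\in\mathcal{S}_+(\mathcal{H})$ and $M_2^k\in\mathcal{S}_+(\mathcal{G})$ for all $k\ge0$, and assume that $$M_1^k-\frac{L}{2}\mathrm{Id}\in\mathcal{S}_+(\mathcal{H}),\quad M_1^k\succcurlyeq M_1^{k+1},\quad M_2^k\succcurlyeq M_2^{k+1}\quad\text{for all } k\ge0.$$ Let $(x^k,z^k,y^k)_{k\ge0}$ be the sequence generated by the variable metric ADMM algorithm described in the context. If one of the following assumptions is fulfilled: (I) there exists $\alpha_1>0$ such that $M_1^k-\frac{L}{2}\mathrm{Id}\in\mathcal{P}_{\alpha_1}(\mathcal{H})$ for all $k\ge0$; (II) there exist $\alpha,\alpha_2>0$ such that $M_1^k-\frac{L}{2}\mathrm{Id}+A^*A\in\mathcal{P}_{\alpha}(\mathcal{H})$ and $M_2^k\in\mathcal{P}_{\alpha_2}(\mathcal{G})$ for all $k\ge0$; (III) there exists $\alpha>0$ such that $M_1^k-\frac{L}{2}\mathrm{Id}+A^*A\in\mathcal{P}_{\alpha}(\mathcal{H})$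 and $2M_2^{k+1}\succcurlyeq M_2^k\succcurlyeq M_2^{k+1}$ for all $k\ge0$; then $(x^k,z^k,y^k)_{k\ge0}$ converges weakly to a saddle point of the Lagrangian $l$.
   Context: Here $\overline{\mathbb{R}}=\mathbb{R}\cup\{\pm\infty\}$. The Lagrangian $l:\mathcal{H}\times\mathcal{G}\times\mathcal{G}\to\overline{\mathbb{R}}$ is associated with the problem $\inf_{x\in\mathcal{H}}\{f(x)+h(x)+g(Ax)\}$. A point $(x^*,z^*,y^* )\in\mathcal{H}\times\mathcal{G}\times\mathcal{G}$ is a saddle point of $l$ if $l(x^*,z^*,y)\le l(x^*,z^*,y^* )\le l(x,z,y^* )$ for all $(x,z,y)\in\mathcal{H}\times\mathcal{G}\times\mathcal{G}$. $A^*:\mathcal{G}\to\mathcal{H}$ is the adjoint of $A$. $\mathcal{S}_+(\mathcal{H})$ denotes the family of linear, continuous, self-adjoint and positive semidefinite operators $U:\mathcal{H}\to\mathcal{H}$ (similarly $\mathcal{S}_+(\mathcal{G})$). For $U\in\mathcal{S}_+(\mathcal{H})$, $\|x\|_U^2=\langle x,Ux\rangle$. For $U_1,U_2\in\mathcal{S}_+(\mathcal{H})$, $U_1\succcurlyeq U_2$ means $\|x\|_{U_1}^2\ge\|x\|_{U_2}^2$ for all $x\in\mathcal{H}$. $\mathrm{Id}$ is the identity operator. For $\alpha>0$, $\mathcal{P}_\alpha(\mathcal{H})=\{U\in\mathcal{S}_+(\mathcal{H}):U\succcurlyeq\alpha\,\mathrm{Id}\}$ (similarly $\mathcal{P}_\alpha(\mathcal{G})$).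 Variable metric ADMM algorithm: choose $(x^0,z^0,y^0)\in\mathcal{H}\times\mathcal{G}\times\mathcal{G}$ and $c>0$, and for all $k\ge0$ let $$x^{k+1}\in\operatorname{argmin}_{x\in\mathcal{H}}\left\{f(x)+\langle x-x^k,\nabla h(x^k)\rangle+\frac{c}{2}\|Ax-z^k+c^{-1}y^k\|^2+\frac12\|x-x^k\|_{M_1^k}^2\right\},$$ $$z^{k+1}=\operatorname{argmin}_{z\in\mathcal{G}}\left\{g(z)+\frac{c}{2}\|Ax^{k+1}-z+c^{-1}y^k\|^2+\frac12\|z-z^k\|_{M_2^k}^2\right\},$$ $$y^{k+1}=y^k+c(Ax^{k+1}-z^{k+1}).$$ A sequence generated by the algorithm is any sequence satisfying these relations for all $k\ge0$. *)

theory Defs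
  imports "HOL-Analysis.Analysis"
begin

text \<open>
  A real Hilbert space is a type of sort \<open>{real_inner, complete_space}\<close>; continuous linear
  operators are functions satisfying \<open>bounded_linear\<close>.
\<close>

definition proper_fun :: "('a \<Rightarrow> ereal) \<Rightarrow> bool" where
  "proper_fun f \<longleftrightarrow> (\<forall>x. f x \<noteq> -\<infinity>) \<and> (\<exists>x. f x \<noteq> \<infinity>)"

text \<open>
  In \<^typ>\<open>ereal\<close>, \<open>\<infinity> + (-\<infinity>) = \<infinity>\<close>, which is the convention making the inequality below equivalent
  to convexity of the epigraph also for functions that are not proper.
\<close>

definition convex_fun :: "('a::real_vector \<Rightarrow> ereal) \<Rightarrow> bool" where
  "convex_fun f \<longleftrightarrow>
     (\<forall>x y t. 0 < t \<and> t < 1 \<longrightarrow>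
        f (t *\<^sub>R x + (1 - t) *\<^sub>R y) \<le> ereal t * f x + ereal (1 - t) * f y)"

definition lsc_fun :: "('a::topological_space \<Rightarrow> ereal) \<Rightarrow> bool" where
  "lsc_fun f \<longleftrightarrow> (\<forall>x. f x \<le> Liminf (nhds x) f)"

definition argmin :: "('a \<Rightarrow> 'b::ord) \<Rightarrow> 'a set" where
  "argmin F = {x. is_arg_min F (\<lambda>_. True) x}"

definition weakly_tendsto :: "(nat \<Rightarrow> 'a::real_normed_vector) \<Rightarrow> 'a \<Rightarrow> bool" where
  "weakly_tendsto u l \<longleftrightarrow>
     (\<forall>\<phi> :: 'a \<Rightarrow> real. bounded_linear \<phi> \<longrightarrow> (\<lambda>n. \<phi> (u n)) \<longlonglongrightarrow> \<phi> l)"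

definition S_plus :: "('a::real_inner \<Rightarrow> 'a) set" where
  "S_plus = {U. bounded_linear U \<and> (\<forall>x y. U x \<bullet> y = x \<bullet> U y) \<and> (\<forall>x. 0 \<le> x \<bullet> U x)}"

text \<open>\<open>sqnorm_op U x\<close> is the squared seminorm of \<open>x\<close> induced by \<open>U\<close>.\<close>

definition sqnorm_op :: "('a::real_inner \<Rightarrow> 'a) \<Rightarrow> 'a \<Rightarrow> real" where
  "sqnorm_op U x = x \<bullet> U x"

definition op_ge :: "('a::real_inner \<Rightarrow> 'a) \<Rightarrow> ('a \<Rightarrow> 'a) \<Rightarrow> bool" (infix \<open>\<succcurlyeq>\<close> 50) where
  "U1 \<succcurlyeq> U2 \<longleftrightarrow> (\<forall>x. sqnorm_op U1 x \<ge> sqnorm_op U2 x)"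

definition P_alpha :: "real \<Rightarrow> ('a::real_inner \<Rightarrow> 'a) set" where
  "P_alpha \<alpha> = {U \<in> S_plus. U \<succcurlyeq> (\<lambda>x. \<alpha> *\<^sub>R x)}"

definition Lagrangian ::
  "('a::real_inner \<Rightarrow> ereal) \<Rightarrow> ('a \<Rightarrow> real) \<Rightarrow> ('b::real_inner \<Rightarrow> ereal) \<Rightarrow> ('a \<Rightarrow> 'b)
     \<Rightarrow> 'a \<Rightarrow> 'b \<Rightarrow> 'b \<Rightarrow> ereal" where
  "Lagrangian f h g A x z y = f x + ereal (h x) + g z + ereal (y \<bullet> (A x - z))"

definition saddle_point :: "('a \<Rightarrow> 'b \<Rightarrow> 'c \<Rightarrow> ereal) \<Rightarrow> 'a \<times> 'b \<times> 'c \<Rightarrow> bool" where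
  "saddle_point l = (\<lambda>(x', z', y').
     \<forall>x z y. l x' z' y \<le> l x' z' y' \<and> l x' z' y' \<le> l x z y')"

text \<open>
  The argument \<open>dh\<close> is the gradient of the smooth part. The \<open>x\<close>-subproblem may have several
  minimizers; the \<open>z\<close>-subproblem is strongly convex, and \<open>z (Suc k)\<close> is its only minimizer.
\<close>

definition vm_admm ::
  "('a::real_inner \<Rightarrow> ereal) \<Rightarrow> ('b::real_inner \<Rightarrow> ereal) \<Rightarrow> ('a \<Rightarrow> 'a) \<Rightarrow> ('a \<Rightarrow> 'b) \<Rightarrow> real
     \<Rightarrow> (nat \<Rightarrow> 'a \<Rightarrow> 'a) \<Rightarrow> (nat \<Rightarrow> 'b \<Rightarrow> 'b)
     \<Rightarrow> (nat \<Rightarrow> 'a) \<Rightarrow> (nat \<Rightarrow> 'b) \<Rightarrow> (nat \<Rightarrow> 'b) \<Rightarrow> bool" where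
  "vm_admm f g dh A c M1 M2 x z y \<longleftrightarrow> (\<forall>k.
     x (Suc k) \<in> argmin (\<lambda>u. f u + ereal ((u - x k) \<bullet> dh (x k)
         + c / 2 * (norm (A u - z k + inverse c *\<^sub>R y k))\<^sup>2
         + 1 / 2 * sqnorm_op (M1 k) (u - x k))) \<and>
     argmin (\<lambda>w. g w + ereal (c / 2 * (norm (A (x (Suc k)) - w + inverse c *\<^sub>R y k))\<^sup>2
         + 1 / 2 * sqnorm_op (M2 k) (w - z k))) = {z (Suc k)} \<and>
     y (Suc k) = y k + c *\<^sub>R (A (x (Suc k)) - z (Suc k)))"

end

theory Submission
  imports Defs "HOL-Complex_Analysis.Great_Picard"
begin

text \<open>
  Every saddle point \<open>(x', z', y')\<close> of the Lagrangian gives a Lyapunov function: the squared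
  distance of \<open>(x k, z k, y k)\<close> to it in the metric \<open>diag(M1 k, M2 k + c Id, c\<inverse> Id)\<close>. Adding the
  subgradient inequalities of the two subproblems to those of the saddle point, with cocoercivity of
  the gradient for the smooth part, its decrease in step \<open>k\<close>, whose increments are \<open>dx\<close>, \<open>dz\<close>,
  \<open>dy\<close>, is at least
  \<open>\<parallel>dx\<parallel>\<^sup>2\<close> in the metric \<open>M1 k - L/2 Id\<close>, plus \<open>\<parallel>dz\<parallel>\<^sup>2\<close> in the metric \<open>M2 k\<close>, plus
  \<open>c \<parallel>A (x (k+1)) - z k\<parallel>\<^sup>2\<close>. Each of the three alternative assumptions then forces \<open>dz \<longlonglongrightarrow> 0\<close>, and
  with it \<open>dx\<close> and \<open>dy\<close>. Passing to the limit in the subgradient inequalities shows that weak cluster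
  points are saddle points, and since decreasing sequences of positive operators converge strongly,
  Opial's argument works in the varying metric.
\<close>

subsection \<open>Projections and weak convergence in Hilbert spaces\<close>

text \<open>Completeness takes the place of compactness: midpoints of a minimizing sequence stay in
  the convex set, so the parallelogram identity makes the sequence Cauchy. The obtuse-angle
  inequality at its limit is what separation and Riesz representation rest on.\<close>

lemma closest_point_complete:
  fixes C :: "'a::{real_inner, complete_space} set"
  assumes "closed C" "convex C" "C \<noteq> {}"
  obtains p where "p \<in> C" "\<And>w. w \<in> C \<Longrightarrow> (u - p) \<bullet> (w - p) \<le> 0"
proof -
  define d where "d = (INF w\<in>C. (dist u w)\<^sup>2)"
  have bdd: "bdd_below ((\<lambda>w. (dist u w)\<^sup>2) ` C)"
    by (rule bdd_belowI2[of _ 0]) simp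
  have d_le: "d \<le> (dist u w)\<^sup>2" if "w \<in> C" for w
    unfolding d_def using bdd that by (rule cINF_lower)
  have "\<exists>w\<in>C. (dist u w)\<^sup>2 < d + inverse (real (Suc n))" for n
    using cInf_lessD[of "(\<lambda>w. (dist u w)\<^sup>2) ` C" "d + inverse (real (Suc n))"] assms(3)
    unfolding d_def by auto
  then obtain w where w: "\<And>n. w n \<in> C" "\<And>n. (dist u (w n))\<^sup>2 < d + inverse (real (Suc n))"
    by metis
  have parallelogram: "(dist (w m) (w n))\<^sup>2 \<le> 2 * inverse (real (Suc m)) + 2 * inverse (real (Suc n))" for m n
  proof -
    have "(1 / 2) *\<^sub>R w m + (1 / 2) *\<^sub>R w n \<in> C"
      using \<open>convex C\<close> w(1) by (rule convexD) (use w in auto)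
    from d_le[OF this] have "4 * d \<le> 4 * (norm (u - ((1 / 2) *\<^sub>R w m + (1 / 2) *\<^sub>R w n)))\<^sup>2"
      by (simp add: dist_norm)
    also have "4 * (norm (u - ((1 / 2) *\<^sub>R w m + (1 / 2) *\<^sub>R w n)))\<^sup>2 =
       2 * (dist u (w m))\<^sup>2 + 2 * (dist u (w n))\<^sup>2 - (dist (w m) (w n))\<^sup>2"
      unfolding dist_norm power2_norm_eq_inner
      by (simp add: inner_diff_left inner_diff_right inner_add_left inner_add_right inner_commute field_simps)
    finally show ?thesis using w(2)[of m] w(2)[of n] by linarith
  qed
  have "Cauchy w"
  proof (rule metric_CauchyI)
    fix e :: real assume "0 < e"
    \<comment> \<open>The 4 is the sum of the two coefficients in
      \<open>parallelogram\<close>.\<close>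
    then obtain N where N: "inverse (real (Suc N)) < e\<^sup>2 / 4"
      using reals_Archimedean[of "e\<^sup>2 / 4"] by auto
    have "dist (w m) (w n) < e" if "m \<ge> N" "n \<ge> N" for m n
    proof -
      have "inverse (real (Suc m)) \<le> inverse (real (Suc N))" "inverse (real (Suc n)) \<le> inverse (real (Suc N))"
        using that by (auto intro!: le_imp_inverse_le)
      with parallelogram[of m n] N have "(dist (w m) (w n))\<^sup>2 < e\<^sup>2" by linarith
      then show ?thesis using \<open>0 < e\<close> by (simp add: power_less_imp_less_base)
    qed
    then show "\<exists>N. \<forall>m\<ge>N. \<forall>n\<ge>N. dist (w m) (w n) < e" by blast
  qed
  then obtain p where p: "w \<longlonglongrightarrow> p"
    using Cauchy_convergent convergent_def by blast
  have "p \<in> C" using closed_sequentially[OF \<open>closed C\<close> _ p] w(1) by blast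
  have "(\<lambda>n. d + inverse (real (Suc n))) \<longlonglongrightarrow> d + 0"
    by (intro tendsto_intros LIMSEQ_inverse_real_of_nat)
  moreover have "(\<lambda>n. (dist u (w n))\<^sup>2) \<longlonglongrightarrow> (dist u p)\<^sup>2"
    using p by (intro tendsto_intros)
  ultimately have "(dist u p)\<^sup>2 \<le> d"
    using w(2) by (intro LIMSEQ_le[of "\<lambda>n. (dist u (w n))\<^sup>2" _ "\<lambda>n. d + inverse (real (Suc n))"])
      (auto intro: less_imp_le exI[of _ 0])
  then have "\<forall>v\<in>C. dist u p \<le> dist u v"
    using d_le by (meson order_trans power2_le_imp_le zero_le_dist)
  then have "(u - p) \<bullet> (v - p) \<le> 0" if "v \<in> C" for v
    using any_closest_point_dot[OF \<open>convex C\<close> \<open>closed C\<close> \<open>p \<in> C\<close> that] by blast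
  with \<open>p \<in> C\<close> that show ?thesis by blast
qed

text \<open>The point of least norm on the hyperplane where \<open>\<phi>\<close> equals 1 is
  orthogonal to the kernel, and a multiple of it represents \<open>\<phi>\<close>. Linearity and
  boundedness are asked on \<open>V\<close> alone, because weak compactness applies this to a limit
  functional that is controlled only there.\<close>

lemma riesz_on_closed_subspace:
  fixes V :: "'a::{real_inner, complete_space} set" and \<phi> :: "'a \<Rightarrow> real"
  assumes "closed V" "subspace V"
    and add: "\<And>v w. v \<in> V \<Longrightarrow> w \<in> V \<Longrightarrow> \<phi> (v + w) = \<phi> v + \<phi> w"
    and scale: "\<And>r v. v \<in> V \<Longrightarrow> \<phi> (r *\<^sub>R v) = r * \<phi> v"
    and bound: "\<And>v. v \<in> V \<Longrightarrow> \<bar>\<phi> v\<bar> \<le> K * norm v"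
  obtains p where "p \<in> V" "\<And>v. v \<in> V \<Longrightarrow> \<phi> v = p \<bullet> v"
proof (cases "\<forall>v\<in>V. \<phi> v = 0")
  case True
  then show ?thesis using that[of 0] \<open>subspace V\<close> by (simp add: subspace_0)
next
  case False
  note sub = subspace_add[OF \<open>subspace V\<close>] subspace_scale[OF \<open>subspace V\<close>] subspace_diff[OF \<open>subspace V\<close>]
  have diff: "\<phi> (v - w) = \<phi> v - \<phi> w" if "v \<in> V" "w \<in> V" for v w
    using add[of v "- 1 *\<^sub>R w"] scale[of w "-1"] sub(2)[of w "-1"] that by simp
  define C where "C = {v \<in> V. \<phi> v = 1}"
  from False obtain v0 where v0: "v0 \<in> V" "\<phi> v0 \<noteq> 0" by blast
  then have "inverse (\<phi> v0) *\<^sub>R v0 \<in> C" unfolding C_def using sub by (simp add: scale)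
  then have "C \<noteq> {}" by blast
  have "convex C" unfolding convex_def C_def using sub by (auto simp: add scale)
  have "closed C"
    unfolding closed_sequential_limits
  proof (intro allI impI, elim conjE)
    fix s l assume s: "\<forall>n. s n \<in> C" "s \<longlonglongrightarrow> l"
    then have "l \<in> V" using closed_sequentially[OF \<open>closed V\<close>, of s l] by (simp add: C_def)
    have le: "\<bar>1 - \<phi> l\<bar> \<le> K * norm (s n - l)" for n
      using bound[of "s n - l"] s(1) \<open>l \<in> V\<close> sub(3) diff[of "s n" l] by (simp add: C_def)
    have "(\<lambda>n. K * norm (s n - l)) \<longlonglongrightarrow> K * norm (l - l)"
      using s(2) by (intro tendsto_intros)
    then have "\<bar>1 - \<phi> l\<bar> \<le> 0"
      using LIMSEQ_le_const[of "\<lambda>n. K * norm (s n - l)" 0 "\<bar>1 - \<phi> l\<bar>"] le by simp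
    with \<open>l \<in> V\<close> show "l \<in> C" by (simp add: C_def)
  qed
  obtain p where p: "p \<in> C" "\<And>w. w \<in> C \<Longrightarrow> (0 - p) \<bullet> (w - p) \<le> 0"
    using closest_point_complete[OF \<open>closed C\<close> \<open>convex C\<close> \<open>C \<noteq> {}\<close>] by metis
  then have pV: "p \<in> V" "\<phi> p = 1" by (auto simp: C_def)
  have "p \<noteq> 0" using pV scale[of p 0] by auto
  have ker: "p \<bullet> v = 0" if "v \<in> V" "\<phi> v = 0" for v
  proof -
    \<comment> \<open>Moving by \<open>v\<close> and by \<open>- v\<close> stays on the hyperplane,
      so the obtuse-angle inequality holds with both signs.\<close>
    have "p + v \<in> C" "p - v \<in> C" using that pV sub by (auto simp: C_def add diff)
    from p(2)[OF this(1)] p(2)[OF this(2)] show ?thesis by simp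
  qed
  have "\<phi> v = (inverse (p \<bullet> p) *\<^sub>R p) \<bullet> v" if "v \<in> V" for v
  proof -
    have "p \<bullet> (v - \<phi> v *\<^sub>R p) = 0"
      using that pV sub by (intro ker) (auto simp: diff scale)
    then show ?thesis using \<open>p \<noteq> 0\<close> by (simp add: inner_diff_right field_simps)
  qed
  with pV sub that show ?thesis by blast
qed

lemma riesz_representation:
  fixes \<phi> :: "'a::{real_inner, complete_space} \<Rightarrow> real"
  assumes "bounded_linear \<phi>"
  obtains p where "\<And>v. \<phi> v = p \<bullet> v"
proof -
  interpret bounded_linear \<phi> by fact
  show ?thesis
    by (rule riesz_on_closed_subspace[of UNIV \<phi> "onorm \<phi>"])
      (use that onorm[OF assms] in \<open>auto simp: add scale\<close>)
qed

text \<open>\<open>adjoint\<close> is defined by choice; representing the functional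
  \<open>\<lambda>x. A x \<bullet> y\<close> for each \<open>y\<close> supplies the witness.\<close>

lemma adjoint_works_complete:
  fixes A :: "'a::{real_inner, complete_space} \<Rightarrow> 'b::real_inner"
  assumes "bounded_linear A"
  shows "x \<bullet> adjoint A y = A x \<bullet> y"
proof -
  have "\<exists>w. \<forall>x. A x \<bullet> y = x \<bullet> w" for y
    using riesz_representation[OF bounded_linear_compose[OF bounded_linear_inner_left assms], of y]
    by (metis inner_commute)
  then have "\<exists>A'. \<forall>x y. A x \<bullet> y = x \<bullet> A' y" by metis
  then show ?thesis unfolding adjoint_def by (rule someI2_ex) simp
qed

section \<open>Weak limits, weakly closed sets and weak sequential compactness\<close>

lemma weakly_tendsto_iff_inner:
  fixes u :: "nat \<Rightarrow> 'a::{real_inner, complete_space}"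
  shows "weakly_tendsto u l \<longleftrightarrow> (\<forall>v. (\<lambda>n. v \<bullet> u n) \<longlonglongrightarrow> v \<bullet> l)"
proof
  assume "weakly_tendsto u l"
  then show "\<forall>v. (\<lambda>n. v \<bullet> u n) \<longlonglongrightarrow> v \<bullet> l"
    unfolding weakly_tendsto_def using bounded_linear_inner_right by blast
next
  assume u: "\<forall>v. (\<lambda>n. v \<bullet> u n) \<longlonglongrightarrow> v \<bullet> l"
  show "weakly_tendsto u l" unfolding weakly_tendsto_def
  proof (intro allI impI)
    fix \<phi> :: "'a \<Rightarrow> real" assume "bounded_linear \<phi>"
    then obtain p where "\<And>v. \<phi> v = p \<bullet> v" using riesz_representation by blast
    with u show "(\<lambda>n. \<phi> (u n)) \<longlonglongrightarrow> \<phi> l" by simp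
  qed
qed

lemma weakly_tendsto_bounded_linear:
  fixes T :: "'a::real_normed_vector \<Rightarrow> 'b::real_normed_vector"
  assumes "weakly_tendsto u l" "bounded_linear T"
  shows "weakly_tendsto (\<lambda>n. T (u n)) (T l)"
  unfolding weakly_tendsto_def
proof (intro allI impI)
  fix \<phi> :: "'b \<Rightarrow> real" assume "bounded_linear \<phi>"
  then have "bounded_linear (\<lambda>v. \<phi> (T v))" using assms(2) by (rule bounded_linear_compose)
  with assms(1)[unfolded weakly_tendsto_def, THEN spec, of "\<lambda>v. \<phi> (T v)"]
  show "(\<lambda>n. \<phi> (T (u n))) \<longlonglongrightarrow> \<phi> (T l)" by blast
qed

text \<open>Lets a subsequence be shifted by one iteration without changing its weak limit once the
  increments vanish.\<close>

lemma weakly_tendsto_add_null: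
  fixes u d :: "nat \<Rightarrow> 'a::real_normed_vector"
  assumes "weakly_tendsto u l" "d \<longlonglongrightarrow> 0"
  shows "weakly_tendsto (\<lambda>n. u n + d n) l"
  unfolding weakly_tendsto_def
proof (intro allI impI)
  fix \<phi> :: "'a \<Rightarrow> real" assume \<phi>: "bounded_linear \<phi>"
  have "(\<lambda>n. \<phi> (u n) + \<phi> (d n)) \<longlonglongrightarrow> \<phi> l + \<phi> 0"
    using assms(1) \<phi> by (intro tendsto_add bounded_linear.tendsto[OF \<phi> assms(2)]) (simp add: weakly_tendsto_def)
  then show "(\<lambda>n. \<phi> (u n + d n)) \<longlonglongrightarrow> \<phi> l"
    using \<phi> by (simp add: linear_simps)
qed

lemma weakly_tendsto_strongly_inner:
  fixes u :: "nat \<Rightarrow> 'a::{real_inner, complete_space}"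
  assumes "weakly_tendsto u l" "bounded (range u)" "w \<longlonglongrightarrow> v"
  shows "(\<lambda>n. w n \<bullet> u n) \<longlonglongrightarrow> v \<bullet> l"
proof -
  from assms(2) obtain B where B: "\<And>n. norm (u n) \<le> B" by (auto simp: bounded_iff)
  have "(\<lambda>n. norm (w n - v) * B) \<longlonglongrightarrow> norm (v - v) * B" using assms(3) by (intro tendsto_intros)
  moreover have "norm ((w n - v) \<bullet> u n) \<le> norm (w n - v) * B" for n
    using order_trans[OF Cauchy_Schwarz_ineq2[of "w n - v" "u n"] mult_left_mono[OF B[of n] norm_ge_zero]]
    by simp
  ultimately have "(\<lambda>n. (w n - v) \<bullet> u n) \<longlonglongrightarrow> 0"
    using Lim_null_comparison[of "\<lambda>n. (w n - v) \<bullet> u n" "\<lambda>n. norm (w n - v) * B" sequentially]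
    by simp
  moreover have "(\<lambda>n. v \<bullet> u n) \<longlonglongrightarrow> v \<bullet> l" using assms(1) by (simp add: weakly_tendsto_iff_inner)
  ultimately have "(\<lambda>n. (w n - v) \<bullet> u n + v \<bullet> u n) \<longlonglongrightarrow> 0 + v \<bullet> l" by (rule tendsto_add)
  then show ?thesis by (simp add: inner_diff_left)
qed

text \<open>Let \<open>p\<close> be the projection of \<open>l\<close> onto \<open>C\<close>. The
  functional given by \<open>l - p\<close> is at most 0 on \<open>C - p\<close>, while along the
  sequence it tends to the squared distance of \<open>l\<close> from \<open>C\<close>. Visiting
  \<open>C\<close> infinitely often is enough for the contradiction.\<close>

lemma weakly_closed:
  fixes u :: "nat \<Rightarrow> 'a::{real_inner, complete_space}"
  assumes "closed C" "convex C" "weakly_tendsto u l" "frequently (\<lambda>n. u n \<in> C) sequentially"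
  shows "l \<in> C"
proof -
  from assms(4) have "C \<noteq> {}" by (auto dest: frequently_ex)
  obtain p where p: "p \<in> C" "\<And>w. w \<in> C \<Longrightarrow> (l - p) \<bullet> (w - p) \<le> 0"
    using closest_point_complete[OF assms(1,2) \<open>C \<noteq> {}\<close>] by blast
  have "(\<lambda>n. (l - p) \<bullet> u n - (l - p) \<bullet> p) \<longlonglongrightarrow> (l - p) \<bullet> l - (l - p) \<bullet> p"
    using assms(3) by (intro tendsto_diff tendsto_const) (simp add: weakly_tendsto_iff_inner)
  then have lim: "(\<lambda>n. (l - p) \<bullet> (u n - p)) \<longlonglongrightarrow> (l - p) \<bullet> (l - p)" by (simp add: inner_diff_right)
  have "\<not> 0 < (l - p) \<bullet> (l - p)"
  proof
    assume "0 < (l - p) \<bullet> (l - p)"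
    from order_tendstoD(1)[OF lim this] have "eventually (\<lambda>n. u n \<notin> C) sequentially"
      by (rule eventually_mono) (use p(2) in force)
    with assms(4) show False by (simp add: frequently_def)
  qed
  then show ?thesis using p(1) by simp
qed

text \<open>Separability is avoided by diagonalizing only over inner products with the terms of the
  sequence itself. The vectors at which these converge form a closed subspace \<open>V\<close>
  containing the sequence; Riesz on \<open>V\<close> gives the limit, and any other vector acts
  through its projection onto \<open>V\<close>.\<close>

lemma bounded_imp_weakly_convergent_subseq:
  fixes u :: "nat \<Rightarrow> 'a::{real_inner, complete_space}"
  assumes "bounded (range u)"
  obtains r l where "strict_mono (r :: nat \<Rightarrow> nat)" "weakly_tendsto (u \<circ> r) l"
proof -
  from assms obtain B where B: "\<And>n. norm (u n) \<le> B" by (auto simp: bounded_iff)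
  then have "0 \<le> B" using norm_ge_zero order_trans by blast
  have le: "norm (u n \<bullet> v) \<le> B * norm v" for n v
    using Cauchy_Schwarz_ineq2[of "u n" v] mult_right_mono[OF B[of n], of "norm v"] by simp
  have le2: "norm (u n \<bullet> v) \<le> B * B" if "v \<in> range u" for n v
    using le[of n v] that B \<open>0 \<le> B\<close> by (auto intro: order_trans mult_left_mono)
  \<comment> \<open>Diagonal extraction over the countable index set \<open>range u\<close>.\<close>
  obtain r :: "nat \<Rightarrow> nat" where r: "strict_mono r"
    "\<And>v. v \<in> range u \<Longrightarrow> \<exists>l. (\<lambda>n. u (r n) \<bullet> v) \<longlonglongrightarrow> l"
    using function_convergent_subsequence[of "range u" "\<lambda>n v. u n \<bullet> v" "B * B"] le2 by auto
  define V where "V = {v. convergent (\<lambda>n. u (r n) \<bullet> v)}"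
  define \<phi> where "\<phi> v = lim (\<lambda>n. u (r n) \<bullet> v)" for v
  have lim: "(\<lambda>n. u (r n) \<bullet> v) \<longlonglongrightarrow> \<phi> v" if "v \<in> V" for v
    using that by (simp add: V_def \<phi>_def convergent_LIMSEQ_iff)
  have "subspace V"
    unfolding subspace_def V_def
    by (auto simp: inner_add_right convergent_const intro: convergent_add convergent_mult)
  have "closed V"
    unfolding closed_sequential_limits
  proof (intro allI impI, elim conjE)
    fix s l assume s: "\<forall>n. s n \<in> V" "s \<longlonglongrightarrow> l"
    \<comment> \<open>Three-epsilon argument: replacing \<open>l\<close> by \<open>s k\<close> costs
      at most \<open>B * norm (l - s k)\<close>, uniformly in \<open>n\<close>.\<close>
    have "Cauchy (\<lambda>n. u (r n) \<bullet> l)"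
    proof (rule metric_CauchyI)
      fix e :: real assume "0 < e"
      have "(\<lambda>n. B * norm (l - s n)) \<longlonglongrightarrow> B * norm (l - l)"
        using s(2) by (intro tendsto_intros)
      then have "eventually (\<lambda>n. B * norm (l - s n) < e / 3) sequentially"
        using \<open>0 < e\<close> by (intro order_tendstoD(2)) auto
      then obtain k where k: "B * norm (l - s k) < e / 3"
        using eventually_happens sequentially_bot by blast
      have "Cauchy (\<lambda>n. u (r n) \<bullet> s k)" using s(1) by (simp add: V_def Cauchy_convergent_iff)
      then obtain N where N: "\<forall>m\<ge>N. \<forall>n\<ge>N. dist (u (r m) \<bullet> s k) (u (r n) \<bullet> s k) < e / 3"
        unfolding Cauchy_def using \<open>0 < e\<close> by (meson divide_pos_pos zero_less_numeral)
      have "dist (u (r m) \<bullet> l) (u (r n) \<bullet> l) < e" if "m \<ge> N" "n \<ge> N" for m n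
      proof -
        have "dist (u (r m) \<bullet> s k) (u (r n) \<bullet> s k) < e / 3" using N that by blast
        with le[of "r m" "l - s k"] le[of "r n" "l - s k"] k show ?thesis
          unfolding dist_real_def inner_diff_right real_norm_def by linarith
      qed
      then show "\<exists>N. \<forall>m\<ge>N. \<forall>n\<ge>N. dist (u (r m) \<bullet> l) (u (r n) \<bullet> l) < e" by blast
    qed
    then show "l \<in> V" by (simp add: V_def Cauchy_convergent_iff)
  qed
  obtain p where p: "p \<in> V" "\<And>v. v \<in> V \<Longrightarrow> \<phi> v = p \<bullet> v"
  proof (rule riesz_on_closed_subspace[OF \<open>closed V\<close> \<open>subspace V\<close>, of \<phi> B])
    show "\<phi> (v + w) = \<phi> v + \<phi> w" if "v \<in> V" "w \<in> V" for v w
      using tendsto_add[OF lim[OF that(1)] lim[OF that(2)]] lim[OF subspace_add[OF \<open>subspace V\<close> that]]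
      by (simp add: inner_add_right LIMSEQ_unique)
    show "\<phi> (a *\<^sub>R v) = a * \<phi> v" if "v \<in> V" for a v
      using tendsto_mult_left[OF lim[OF that], of a] lim[OF subspace_scale[OF \<open>subspace V\<close> that, of a]]
      by (simp add: LIMSEQ_unique)
    show "\<bar>\<phi> v\<bar> \<le> B * norm v" if "v \<in> V" for v
      using LIMSEQ_le_const2[OF tendsto_norm[OF lim[OF that]], of "B * norm v"] le by auto
  qed (rule that)
  have "(\<lambda>n. v \<bullet> u (r n)) \<longlonglongrightarrow> v \<bullet> p" for v
  proof -
    \<comment> \<open>\<open>q\<close> is the orthogonal projection of \<open>v\<close> onto
      \<open>V\<close>.\<close>
    obtain q where q: "q \<in> V" "\<And>w. w \<in> V \<Longrightarrow> v \<bullet> w = q \<bullet> w"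
      by (rule riesz_on_closed_subspace[OF \<open>closed V\<close> \<open>subspace V\<close>, of "\<lambda>w. v \<bullet> w" "norm v"])
        (auto simp: inner_add_right Cauchy_Schwarz_ineq2)
    have "u n \<in> V" for n using r(2)[of "u n"] by (auto simp: V_def convergent_def)
    then have "(\<lambda>n. v \<bullet> u (r n)) = (\<lambda>n. u (r n) \<bullet> q)"
      by (simp add: q(2) inner_commute[of _ q])
    moreover have "v \<bullet> p = \<phi> q" using q(2)[OF p(1)] p(2)[OF q(1)] by (simp add: inner_commute)
    ultimately show ?thesis using lim[OF q(1)] by simp
  qed
  then have "weakly_tendsto (u \<circ> r) p" by (simp add: weakly_tendsto_iff_inner)
  with r(1) show ?thesis by (rule that)
qed

lemma weakly_tendsto_unique:
  fixes u :: "nat \<Rightarrow> 'a::{real_inner, complete_space}"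
  assumes "weakly_tendsto u a" "weakly_tendsto u b"
  shows "a = b"
proof -
  have "(a - b) \<bullet> a = (a - b) \<bullet> b"
    using assms LIMSEQ_unique unfolding weakly_tendsto_iff_inner by blast
  then have "(a - b) \<bullet> (a - b) = 0" by (simp add: inner_diff_right)
  then show ?thesis by simp
qed

lemma tendsto_inner_bounded_null:
  fixes a b :: "nat \<Rightarrow> 'a::real_inner"
  assumes "bounded (range a)" "b \<longlonglongrightarrow> 0"
  shows "(\<lambda>n. a n \<bullet> b n) \<longlonglongrightarrow> 0"
proof -
  from assms(1) obtain B where B: "\<And>n. norm (a n) \<le> B" by (auto simp: bounded_iff)
  have "norm (a n \<bullet> b n) \<le> B * norm (b n)" for n
    using order_trans[OF Cauchy_Schwarz_ineq2[of "a n" "b n"] mult_right_mono[OF B[of n] norm_ge_zero]]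
    by simp
  moreover have "(\<lambda>n. B * norm (b n)) \<longlonglongrightarrow> B * norm (0::'a)"
    by (intro tendsto_intros assms(2))
  ultimately show ?thesis
    using Lim_null_comparison[of "\<lambda>n. a n \<bullet> b n" "\<lambda>n. B * norm (b n)" sequentially] by simp
qed

subsection \<open>Monotone sequences of positive operators\<close>

lemma S_plusD:
  assumes "U \<in> S_plus"
  shows "bounded_linear U" "U x \<bullet> y = x \<bullet> U y" "0 \<le> sqnorm_op U x"
  using assms by (auto simp: S_plus_def sqnorm_op_def)

lemma sqnorm_op_diff:
  assumes "U \<in> S_plus"
  shows "sqnorm_op U (a - b) = sqnorm_op U a - 2 * (a \<bullet> U b) + sqnorm_op U b"
  using S_plusD(2)[OF assms, of b a]
  by (simp add: sqnorm_op_def linear_simps(2)[OF S_plusD(1)[OF assms]] inner_diff_left inner_diff_right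
      inner_commute)

lemma sqnorm_op_scaleR:
  assumes "U \<in> S_plus"
  shows "sqnorm_op U (t *\<^sub>R a) = t\<^sup>2 * sqnorm_op U a"
  by (simp add: sqnorm_op_def linear_simps(5)[OF S_plusD(1)[OF assms]] power2_eq_square)

lemma sqnorm_op_add:
  assumes "U \<in> S_plus"
  shows "sqnorm_op U (a + b) = sqnorm_op U a + 2 * (a \<bullet> U b) + sqnorm_op U b"
  using S_plusD(2)[OF assms, of b a]
  by (simp add: sqnorm_op_def linear_simps(1)[OF S_plusD(1)[OF assms]] inner_add_left inner_add_right
      inner_commute)

text \<open>The usual discriminant argument for a form that may be degenerate, which is why null
  vectors of the seminorm form a separate case.\<close>

lemma S_plus_Cauchy_Schwarz:
  assumes "U \<in> S_plus"
  shows "(v \<bullet> U w)\<^sup>2 \<le> sqnorm_op U v * sqnorm_op U w"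
proof -
  have nonneg: "0 \<le> sqnorm_op U v - 2 * t * (v \<bullet> U w) + t\<^sup>2 * sqnorm_op U w" for t
    using S_plusD(3)[OF assms, of "v - t *\<^sub>R w"]
    by (simp add: sqnorm_op_diff[OF assms] sqnorm_op_scaleR[OF assms]
        linear_simps(5)[OF S_plusD(1)[OF assms]])
  show ?thesis
  proof (cases "sqnorm_op U w = 0")
    case True
    have "v \<bullet> U w = 0"
    proof (rule ccontr)
      assume "v \<bullet> U w \<noteq> 0"
      \<comment> \<open>With a vanishing quadratic coefficient the expression is affine in
        \<open>t\<close>; this \<open>t\<close> gives it the value -1.\<close>
      then show False
        using nonneg[of "(sqnorm_op U v + 1) / (2 * (v \<bullet> U w))"] True by simp
    qed
    then show ?thesis using True by simp
  next
    case False
    then have pos: "0 < sqnorm_op U w" using S_plusD(3)[OF assms, of w] by simp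
    \<comment> \<open>The quadratic in \<open>t\<close> is evaluated at its minimizer.\<close>
    have "0 \<le> sqnorm_op U v - (v \<bullet> U w)\<^sup>2 / sqnorm_op U w"
      using nonneg[of "(v \<bullet> U w) / sqnorm_op U w"] pos
      by (simp add: power2_eq_square field_simps)
    then show ?thesis using pos by (simp add: field_simps)
  qed
qed

lemma sqnorm_op_le_onorm:
  assumes "U \<in> S_plus"
  shows "sqnorm_op U w \<le> onorm U * (norm w)\<^sup>2"
proof -
  have "sqnorm_op U w \<le> norm w * norm (U w)"
    unfolding sqnorm_op_def by (rule norm_cauchy_schwarz)
  also have "\<dots> \<le> norm w * (onorm U * norm w)"
    by (intro mult_left_mono onorm S_plusD(1)[OF assms]) simp
  finally show ?thesis by (simp add: power2_eq_square mult_ac)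
qed

lemma norm_power4_le:
  assumes "U \<in> S_plus"
  shows "((norm (U w))\<^sup>2)\<^sup>2 \<le> sqnorm_op U (U w) * sqnorm_op U w"
  using S_plus_Cauchy_Schwarz[OF assms, of "U w" w] by (simp add: power2_norm_eq_inner)

text \<open>Turns a bound on quadratic forms into one on operators: Cauchy--Schwarz at
  \<open>V w\<close> gives a fourth-power estimate, from which \<open>(norm (V w))\<^sup>2\<close>
  cancels. It bounds a whole decreasing family by the operator norm of its first member.\<close>

lemma op_ge_norm_le:
  assumes "U \<in> S_plus" "V \<in> S_plus" "U \<succcurlyeq> V"
  shows "norm (V w) \<le> onorm U * norm w"
proof -
  let ?K = "onorm U"
  have "0 \<le> ?K" using S_plusD(1)[OF assms(1)] by (rule onorm_pos_le)
  have le: "sqnorm_op V x \<le> ?K * (norm x)\<^sup>2" for x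
    using assms(3) sqnorm_op_le_onorm[OF assms(1), of x] by (auto simp: op_ge_def intro: order_trans)
  have "((norm (V w))\<^sup>2)\<^sup>2 \<le> sqnorm_op V (V w) * sqnorm_op V w"
    by (rule norm_power4_le[OF assms(2)])
  also have "\<dots> \<le> (?K * (norm (V w))\<^sup>2) * (?K * (norm w)\<^sup>2)"
    using \<open>0 \<le> ?K\<close> by (intro mult_mono le S_plusD(3)[OF assms(2)]) auto
  finally have "(norm (V w))\<^sup>2 * (norm (V w))\<^sup>2 \<le> (norm (V w))\<^sup>2 * (?K * norm w)\<^sup>2"
    by (simp add: power2_eq_square mult_ac)
  then have "(norm (V w))\<^sup>2 \<le> (?K * norm w)\<^sup>2 \<or> V w = 0"
    by (metis mult_le_cancel_left_pos zero_less_norm_iff zero_less_power)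
  then show ?thesis
    using \<open>0 \<le> ?K\<close> by (auto intro: power2_le_imp_le)
qed

text \<open>The operator inequality \<open>U\<^sup>2 \<le> K U\<close>: for a bounded positive
  operator, a small quadratic form forces a small image vector.\<close>

lemma norm_power2_le_sqnorm_op:
  assumes "U \<in> S_plus" "\<And>w. norm (U w) \<le> K * norm w"
  shows "(norm (U w))\<^sup>2 \<le> K * sqnorm_op U w"
proof (cases "U w = 0")
  case True
  then show ?thesis by (simp add: sqnorm_op_def)
next
  case False
  have "((norm (U w))\<^sup>2)\<^sup>2 \<le> sqnorm_op U (U w) * sqnorm_op U w"
    by (rule norm_power4_le[OF assms(1)])
  also have "sqnorm_op U (U w) \<le> norm (U w) * (K * norm (U w))"
    unfolding sqnorm_op_def
    by (rule order_trans[OF norm_cauchy_schwarz mult_left_mono[OF assms(2) norm_ge_zero]])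
  finally have "(norm (U w))\<^sup>2 * (norm (U w))\<^sup>2 \<le> (norm (U w))\<^sup>2 * (K * sqnorm_op U w)"
    using S_plusD(3)[OF assms(1), of w] by (simp add: mult_right_mono power2_eq_square mult_ac)
  with False show ?thesis
    by (metis mult_le_cancel_left_pos zero_less_norm_iff zero_less_power)
qed

lemma op_ge_trans: "U \<succcurlyeq> V \<Longrightarrow> V \<succcurlyeq> W \<Longrightarrow> U \<succcurlyeq> W"
  unfolding op_ge_def by (meson order_trans)

lemma op_ge_antimono:
  assumes "\<And>k. Q k \<succcurlyeq> Q (Suc k)" "m \<le> n"
  shows "Q m \<succcurlyeq> Q n"
  using assms(2)
proof (induction n rule: dec_induct)
  case base
  then show ?case by (simp add: op_ge_def)
next
  case (step n)
  with assms(1)[of n] show ?case by (blast intro: op_ge_trans)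
qed

lemma S_plus_diff:
  assumes "U \<in> S_plus" "V \<in> S_plus" "U \<succcurlyeq> V"
  shows "(\<lambda>x. U x - V x) \<in> S_plus"
  using assms S_plusD(2)[OF assms(1)] S_plusD(2)[OF assms(2)]
  by (auto simp: S_plus_def op_ge_def sqnorm_op_def inner_diff_left inner_diff_right bounded_linear_sub)

text \<open>The quadratic forms decrease and are nonnegative, hence Cauchy. A difference
  \<open>Q m - Q n\<close> with \<open>m \<le> n\<close> is positive and dominated by
  \<open>Q 0\<close>, so its value at \<open>w\<close> is controlled by the drop of the quadratic
  form.\<close>

lemma antimono_S_plus_strongly_convergent:
  fixes Q :: "nat \<Rightarrow> 'a::{real_inner, complete_space} \<Rightarrow> 'a"
  assumes Q: "\<And>k. Q k \<in> S_plus" "\<And>k. Q k \<succcurlyeq> Q (Suc k)"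
  shows "convergent (\<lambda>k. Q k w)"
proof -
  define K where "K = onorm (Q 0)"
  have "0 \<le> K" unfolding K_def by (intro onorm_pos_le S_plusD(1) Q)
  have le: "(norm (Q m w - Q n w))\<^sup>2 \<le> K * (sqnorm_op (Q m) w - sqnorm_op (Q n) w)" if "m \<le> n" for m n
  proof -
    define D where "D x = Q m x - Q n x" for x
    have D: "D \<in> S_plus"
      unfolding D_def by (intro S_plus_diff Q op_ge_antimono[of Q] that)
    have "Q m \<succcurlyeq> D" using S_plusD(3)[OF Q(1)] by (simp add: op_ge_def D_def sqnorm_op_def inner_diff_right)
    then have "Q 0 \<succcurlyeq> D" using op_ge_antimono[of Q 0 m] Q op_ge_trans by blast
    then have "norm (D x) \<le> K * norm x" for x
      unfolding K_def by (intro op_ge_norm_le Q D)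
    from norm_power2_le_sqnorm_op[OF D this, of w] show ?thesis
      by (simp add: D_def sqnorm_op_def inner_diff_right)
  qed
  have "decseq (\<lambda>k. sqnorm_op (Q k) w)"
    using Q(2) by (intro decseq_SucI) (simp add: op_ge_def)
  then have "convergent (\<lambda>k. sqnorm_op (Q k) w)"
    by (metis decseq_convergent S_plusD(3)[OF Q(1)] convergentI)
  then have cau: "Cauchy (\<lambda>k. sqnorm_op (Q k) w)" by (simp add: Cauchy_convergent_iff)
  have "Cauchy (\<lambda>k. Q k w)"
  proof (rule metric_CauchyI)
    fix e :: real assume "0 < e"
    \<comment> \<open>Dividing by \<open>K + 1\<close> covers \<open>K = 0\<close> as well.\<close>
    then have "0 < e\<^sup>2 / (K + 1)" using \<open>0 \<le> K\<close> by simp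
    then obtain N where N: "\<forall>m\<ge>N. \<forall>n\<ge>N. dist (sqnorm_op (Q m) w) (sqnorm_op (Q n) w) < e\<^sup>2 / (K + 1)"
      using cau unfolding Cauchy_def by meson
    have main: "dist (Q m w) (Q n w) < e" if "m \<ge> N" "m \<le> n" for m n
    proof -
      have "sqnorm_op (Q m) w - sqnorm_op (Q n) w < e\<^sup>2 / (K + 1)"
        using N[rule_format, of m n] that by (auto simp: dist_real_def abs_less_iff)
      then have "K * (sqnorm_op (Q m) w - sqnorm_op (Q n) w) \<le> K * (e\<^sup>2 / (K + 1))"
        using \<open>0 \<le> K\<close> by (intro mult_left_mono) auto
      also have "\<dots> < e\<^sup>2" using \<open>0 \<le> K\<close> \<open>0 < e\<close> by (simp add: field_simps)
      finally have "(norm (Q m w - Q n w))\<^sup>2 < e\<^sup>2" using le[OF that(2)] by linarith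
      then show ?thesis using \<open>0 < e\<close> by (simp add: dist_norm power_less_imp_less_base)
    qed
    have "dist (Q m w) (Q n w) < e" if "m \<ge> N" "n \<ge> N" for m n
      using main[of m n] main[of n m] that by (cases "m \<le> n") (auto simp: dist_commute)
    then show "\<exists>N. \<forall>m\<ge>N. \<forall>n\<ge>N. dist (Q m w) (Q n w) < e" by blast
  qed
  then show ?thesis by (simp add: Cauchy_convergent_iff)
qed

section \<open>Three-point identities and quadratic expansions along a line\<close>

lemma S_plus_three_point:
  assumes "U \<in> S_plus"
  shows "2 * ((p - b) \<bullet> U (b - a)) = sqnorm_op U (a - p) - sqnorm_op U (b - p) - sqnorm_op U (b - a)"
proof -
  have "a - p = (b - p) - (b - a)" by simp
  then have "sqnorm_op U (a - p) = sqnorm_op U (b - p) - 2 * ((b - p) \<bullet> U (b - a)) + sqnorm_op U (b - a)"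
    by (metis sqnorm_op_diff[OF assms])
  then show ?thesis by (simp add: inner_diff_left)
qed

lemma inner_three_point:
  fixes p a b :: "'a::real_inner"
  shows "2 * ((p - b) \<bullet> (b - a)) = (norm (a - p))\<^sup>2 - (norm (b - p))\<^sup>2 - (norm (b - a))\<^sup>2"
  unfolding power2_norm_eq_inner by (simp add: inner_diff_left inner_diff_right inner_commute)

lemma norm_add_scaleR:
  fixes a b :: "'a::real_inner"
  shows "(norm (a + t *\<^sub>R b))\<^sup>2 = (norm a)\<^sup>2 + 2 * t * (a \<bullet> b) + t\<^sup>2 * (norm b)\<^sup>2"
  unfolding power2_norm_eq_inner
  by (simp add: inner_add_left inner_add_right inner_commute power2_eq_square algebra_simps)

lemma sqnorm_op_add_scaleR:
  assumes "U \<in> S_plus"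
  shows "sqnorm_op U (a + t *\<^sub>R b) = sqnorm_op U a + 2 * t * (b \<bullet> U a) + t\<^sup>2 * sqnorm_op U b"
  using S_plusD(2)[OF assms, of a b] unfolding sqnorm_op_add[OF assms] sqnorm_op_scaleR[OF assms]
  by (simp add: linear_simps(5)[OF S_plusD(1)[OF assms]] inner_commute)

text \<open>For two weak cluster points \<open>p\<close> and \<open>q\<close>, polarization makes
  \<open>Q k (p - q) \<bullet> u k\<close> convergent. Since \<open>Q k (p - q)\<close> converges
  strongly to some \<open>t\<close>, evaluating along both subsequences yields
  \<open>t \<bullet> p = t \<bullet> q\<close>. The premise \<open>definite\<close> stands in for a
  uniform lower bound on the metrics and asks for definiteness only between points of
  \<open>S\<close>.\<close>

lemma opial_variable_metric:
  fixes u :: "nat \<Rightarrow> 'a::{real_inner, complete_space}"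
  assumes Q: "\<And>k. Q k \<in> S_plus" "\<And>k. Q k \<succcurlyeq> Q (Suc k)"
    and bdd: "bounded (range u)"
    and fejer: "\<And>p. p \<in> S \<Longrightarrow> convergent (\<lambda>k. sqnorm_op (Q k) (u k - p))"
    and cluster: "\<And>r p. strict_mono r \<Longrightarrow> weakly_tendsto (u \<circ> r) p \<Longrightarrow> p \<in> S"
    and definite: "\<And>p q. p \<in> S \<Longrightarrow> q \<in> S \<Longrightarrow> (\<lambda>k. sqnorm_op (Q k) (p - q)) \<longlonglongrightarrow> 0 \<Longrightarrow> p = q"
  shows "\<exists>p\<in>S. weakly_tendsto u p"
proof -
  have bdd_sub: "bounded (range (u \<circ> r))" for r :: "nat \<Rightarrow> nat"
    using bdd by (rule bounded_subset) auto
  have strong: "\<exists>t. (\<lambda>k. Q k w) \<longlonglongrightarrow> t" for w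
    using antimono_S_plus_strongly_convergent[of Q, OF Q] by (simp add: convergent_def)
  have unique: "p = q"
    if r: "strict_mono r" "weakly_tendsto (u \<circ> r) p" and s: "strict_mono s" "weakly_tendsto (u \<circ> s) q"
    for r s p q
  proof -
    obtain t where t: "(\<lambda>k. Q k (p - q)) \<longlonglongrightarrow> t" using strong by blast
    obtain tp where tp: "(\<lambda>k. Q k p) \<longlonglongrightarrow> tp" using strong by blast
    obtain tq where tq: "(\<lambda>k. Q k q) \<longlonglongrightarrow> tq" using strong by blast
    obtain a b where ab: "(\<lambda>k. sqnorm_op (Q k) (u k - p)) \<longlonglongrightarrow> a" "(\<lambda>k. sqnorm_op (Q k) (u k - q)) \<longlonglongrightarrow> b"
      using fejer[OF cluster[OF r]] fejer[OF cluster[OF s]] by (auto simp: convergent_def)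
    \<comment> \<open>Polarization: the quadratic terms in \<open>u k\<close> cancel between the two
      distances, leaving the inner product identified with \<open>?F k\<close> below.\<close>
    have "(\<lambda>k. (p \<bullet> Q k p - q \<bullet> Q k q - (sqnorm_op (Q k) (u k - p) - sqnorm_op (Q k) (u k - q))) / 2)
      \<longlonglongrightarrow> (p \<bullet> tp - q \<bullet> tq - (a - b)) / 2" (is "?F \<longlonglongrightarrow> ?a")
      by (intro tendsto_intros tp tq ab) simp
    moreover have "?F k = Q k (p - q) \<bullet> u k" for k
      using S_plusD(2)[OF Q(1), of k p "u k"] S_plusD(2)[OF Q(1), of k q "u k"]
      unfolding sqnorm_op_diff[OF Q(1)] linear_simps(2)[OF S_plusD(1)[OF Q(1)]] inner_diff_left
      by (simp add: sqnorm_op_def inner_commute)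
    ultimately have lim: "(\<lambda>k. Q k (p - q) \<bullet> u k) \<longlonglongrightarrow> ?a" by simp
    have "(\<lambda>k. ((\<lambda>k. Q k (p - q)) \<circ> r) k \<bullet> (u \<circ> r) k) \<longlonglongrightarrow> t \<bullet> p"
      by (intro weakly_tendsto_strongly_inner r bdd_sub LIMSEQ_subseq_LIMSEQ t)
    moreover have "(\<lambda>k. ((\<lambda>k. Q k (p - q)) \<circ> s) k \<bullet> (u \<circ> s) k) \<longlonglongrightarrow> t \<bullet> q"
      by (intro weakly_tendsto_strongly_inner s bdd_sub LIMSEQ_subseq_LIMSEQ t)
    ultimately have "t \<bullet> p = ?a" "t \<bullet> q = ?a"
      using LIMSEQ_subseq_LIMSEQ[OF lim r(1)] LIMSEQ_subseq_LIMSEQ[OF lim s(1)]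
      unfolding comp_def by (blast intro: LIMSEQ_unique)+
    then have "(p - q) \<bullet> t = 0" by (simp add: inner_diff_right inner_commute)
    moreover have "(\<lambda>k. sqnorm_op (Q k) (p - q)) \<longlonglongrightarrow> (p - q) \<bullet> t"
      unfolding sqnorm_op_def by (intro tendsto_intros t)
    ultimately show "p = q" using definite[OF cluster[OF r] cluster[OF s]] by simp
  qed
  obtain r0 p where r0: "strict_mono r0" "weakly_tendsto (u \<circ> r0) p"
    using bounded_imp_weakly_convergent_subseq[OF bdd] by blast
  have "weakly_tendsto u p"
  proof (rule ccontr)
    assume "\<not> weakly_tendsto u p"
    \<comment> \<open>A subsequence staying away from \<open>p\<close> in direction \<open>v\<close>
      would have a weakly convergent subsequence, whose limit must be \<open>p\<close> by
      uniqueness.\<close>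
    then obtain v e where e: "0 < e" "\<not> eventually (\<lambda>n. dist (v \<bullet> u n) (v \<bullet> p) < e) sequentially"
      unfolding weakly_tendsto_iff_inner tendsto_iff by blast
    from not_eventually_sequentiallyD[OF e(2)] obtain r :: "nat \<Rightarrow> nat"
      where r: "strict_mono r" "\<And>n. \<not> dist (v \<bullet> u (r n)) (v \<bullet> p) < e" by blast
    obtain s q where s: "strict_mono s" "weakly_tendsto ((u \<circ> r) \<circ> s) q"
      using bounded_imp_weakly_convergent_subseq[OF bdd_sub] by blast
    then have "weakly_tendsto (u \<circ> (r \<circ> s)) q" by (simp add: comp_assoc)
    moreover from this have "q = p" using unique[OF _ _ r0] strict_mono_o[OF r(1) s(1)] by blast
    ultimately have "(\<lambda>n. v \<bullet> u (r (s n))) \<longlonglongrightarrow> v \<bullet> p" by (simp add: weakly_tendsto_iff_inner)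
    from tendstoD[OF this e(1)] r(2) show False by simp
  qed
  with cluster[OF r0] show ?thesis by blast
qed

subsection \<open>Convex functions\<close>

lemma ereal_convex_comb:
  assumes "0 < t" "t < 1"
  shows "ereal t * y + ereal (1 - t) * y = y"
  using assms ereal_left_distrib[of "ereal t" "ereal (1 - t)" y] by (simp flip: one_ereal_def)

lemma convex_sublevel:
  assumes "convex_fun f"
  shows "convex {x. f x \<le> y}"
  unfolding convex_alt
proof safe
  fix a b t assume ab: "f a \<le> y" "f b \<le> y" and t: "0 \<le> t" "t \<le> (1::real)"
  show "f ((1 - t) *\<^sub>R a + t *\<^sub>R b) \<le> y"
  proof (cases "t = 0 \<or> t = 1")
    case True
    then show ?thesis using ab by auto
  next
    case False
    with t have t: "0 < t" "t < 1" by auto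
    have "f (t *\<^sub>R b + (1 - t) *\<^sub>R a) \<le> ereal t * f b + ereal (1 - t) * f a"
      using assms t by (auto simp: convex_fun_def)
    also have "\<dots> \<le> ereal t * y + ereal (1 - t) * y"
      using t ab by (intro add_mono ereal_mult_left_mono) auto
    finally show ?thesis using t by (simp add: ereal_convex_comb add.commute)
  qed
qed

lemma closed_sublevel:
  assumes "lsc_fun f"
  shows "closed {x. f x \<le> y}"
proof -
  have "eventually (\<lambda>v. y < f v) (nhds x)" if "y < f x" for x
    using assms that unfolding lsc_fun_def le_Liminf_iff by blast
  then have "open {x. y < f x}"
    by (subst open_subopen) (force simp: eventually_nhds)
  moreover have "- {x. f x \<le> y} = {x. y < f x}" by auto
  ultimately show ?thesis by (simp add: closed_def)
qed

text \<open>Sublevel sets are closed and convex, hence weakly sequentially closed.\<close>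

lemma weakly_sequentially_lsc:
  fixes f :: "'a::{real_inner, complete_space} \<Rightarrow> ereal"
  assumes "convex_fun f" "lsc_fun f" "weakly_tendsto u l"
  shows "f l \<le> liminf (\<lambda>n. f (u n))"
  unfolding le_Liminf_iff
proof (intro allI impI)
  fix y assume "y < f l"
  show "eventually (\<lambda>n. y < f (u n)) sequentially"
  proof (rule ccontr)
    assume "\<not> ?thesis"
    then have "frequently (\<lambda>n. u n \<in> {x. f x \<le> y}) sequentially"
      by (simp add: frequently_def not_le)
    from weakly_closed[OF closed_sublevel[OF assms(2)] convex_sublevel[OF assms(1)] assms(3) this]
    show False using \<open>y < f l\<close> by simp
  qed
qed

lemma argmin_iff:
  fixes F :: "'a \<Rightarrow> 'b::linorder"
  shows "u \<in> argmin F \<longleftrightarrow> (\<forall>v. F u \<le> F v)"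
  by (auto simp: argmin_def is_arg_min_def not_less)

lemma argmin_finite:
  assumes "proper_fun f" "u \<in> argmin (\<lambda>v. f v + ereal (q v))"
  shows "\<bar>f u\<bar> \<noteq> \<infinity>"
proof -
  from assms(1) obtain v where "f v \<noteq> \<infinity>" by (auto simp: proper_fun_def)
  with assms show ?thesis
    unfolding argmin_iff proper_fun_def by (cases "f u"; cases "f v") (auto dest: spec[of _ v])
qed

text \<open>Compare \<open>u\<close> with points of the segment towards \<open>v\<close>, use
  convexity of \<open>f\<close>, divide by \<open>t\<close> and let \<open>t\<close> tend to 0. Only
  an upper quadratic model of \<open>q\<close> along the segment enters, so one statement serves
  both the quadratic penalties of the subproblems and \<open>h\<close>, through the descent
  lemma.\<close>

lemma argmin_variational:
  assumes "proper_fun f" "convex_fun f" "u \<in> argmin (\<lambda>v. f v + ereal (q v))"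
    and q: "\<And>t. 0 < t \<Longrightarrow> t < 1 \<Longrightarrow> q (u + t *\<^sub>R (v - u)) \<le> q u + t * D + t\<^sup>2 * K"
  shows "f u \<le> f v + ereal D"
proof (cases "f v")
  case (real b)
  obtain a where a: "f u = ereal a" using argmin_finite[OF assms(1,3)] by auto
  have le: "a - b \<le> D + t * K" if t: "0 < t" "t < 1" for t
  proof -
    have "ereal (a + q u) \<le> f (t *\<^sub>R v + (1 - t) *\<^sub>R u) + ereal (q (t *\<^sub>R v + (1 - t) *\<^sub>R u))"
      using assms(3) a by (simp add: argmin_iff)
    also have "\<dots> \<le> ereal (t * b + (1 - t) * a) + ereal (q u + t * D + t\<^sup>2 * K)"
    proof (rule add_mono)
      show "f (t *\<^sub>R v + (1 - t) *\<^sub>R u) \<le> ereal (t * b + (1 - t) * a)"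
        using assms(2) t unfolding convex_fun_def by (metis a real plus_ereal.simps(1) times_ereal.simps(1))
      show "ereal (q (t *\<^sub>R v + (1 - t) *\<^sub>R u)) \<le> ereal (q u + t * D + t\<^sup>2 * K)"
        using q[OF t] by (simp add: algebra_simps)
    qed
    finally have "t * (a - b) \<le> t * (D + t * K)" by (simp add: algebra_simps power2_eq_square)
    then show ?thesis using t by simp
  qed
  \<comment> \<open>The double successor keeps the step strictly below 1.\<close>
  have "(\<lambda>n. D + inverse (real (Suc (Suc n))) * K) \<longlonglongrightarrow> D + 0 * K"
    by (intro tendsto_intros LIMSEQ_Suc[OF LIMSEQ_inverse_real_of_nat])
  then have "a - b \<le> D"
    using le[of "inverse (real (Suc (Suc n)))" for n]
    by (intro LIMSEQ_le_const[of _ D "a - b"]) (auto simp: field_simps)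
  then show ?thesis using a real by simp
qed (use assms(1) in \<open>auto simp: proper_fun_def\<close>)

section \<open>Gradient inequalities for smooth convex functions\<close>

lemma GDERIV_line:
  assumes "\<And>u. GDERIV h u :> dh u"
  shows "((\<lambda>t. h (u + t *\<^sub>R e)) has_real_derivative e \<bullet> dh (u + t *\<^sub>R e)) (at t)"
proof -
  have "((\<lambda>t. u + t *\<^sub>R e) has_derivative (\<lambda>s. s *\<^sub>R e)) (at t)"
    by (auto intro!: derivative_eq_intros)
  from has_derivative_compose[OF this assms[unfolded gderiv_def]]
  show ?thesis by (simp add: has_field_derivative_def mult_commute_abs)
qed

lemma convex_on_gradient:
  fixes h :: "'a::real_inner \<Rightarrow> real"
  assumes "convex_on UNIV h" "\<And>u. GDERIV h u :> dh u"
  shows "h u + (v - u) \<bullet> dh u \<le> h v"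
proof -
  have "convex_on UNIV (\<lambda>t::real. h (u + t *\<^sub>R (v - u)))"
  proof (rule convex_onI)
    fix t a b :: real assume "0 < t" "t < 1"
    have "u + ((1 - t) *\<^sub>R a + t *\<^sub>R b) *\<^sub>R (v - u) =
        (1 - t) *\<^sub>R (u + a *\<^sub>R (v - u)) + t *\<^sub>R (u + b *\<^sub>R (v - u))"
      by (simp add: algebra_simps)
    with convex_onD[OF assms(1), of t] \<open>0 < t\<close> \<open>t < 1\<close>
    show "h (u + ((1 - t) *\<^sub>R a + t *\<^sub>R b) *\<^sub>R (v - u))
      \<le> (1 - t) * h (u + a *\<^sub>R (v - u)) + t * h (u + b *\<^sub>R (v - u))" by simp
  qed simp
  from convex_on_imp_above_tangent[OF this, of 0 1 "(v - u) \<bullet> dh u"]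
    GDERIV_line[of h dh u "v - u" 0, OF assms(2)]
  show ?thesis by simp
qed

text \<open>Along the segment, \<open>h\<close> minus its quadratic model has nonpositive derivative
  by Cauchy--Schwarz and the Lipschitz bound.\<close>

lemma descent_lemma:
  fixes h :: "'a::real_inner \<Rightarrow> real"
  assumes h: "\<And>u. GDERIV h u :> dh u" and L: "L-lipschitz_on UNIV dh"
  shows "h v \<le> h u + (v - u) \<bullet> dh u + L / 2 * (norm (v - u))\<^sup>2"
proof -
  define e where "e = v - u"
  define \<psi> where "\<psi> t = h (u + t *\<^sub>R e) - t * (e \<bullet> dh u) - L / 2 * t\<^sup>2 * (norm e)\<^sup>2" for t
  have "\<exists>y. (\<psi> has_real_derivative y) (at t) \<and> y \<le> 0" if "0 \<le> t" for t
  proof (intro exI conjI)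
    show "(\<psi> has_real_derivative (e \<bullet> dh (u + t *\<^sub>R e) - e \<bullet> dh u - L * t * (norm e)\<^sup>2)) (at t)"
      unfolding \<psi>_def by (rule derivative_eq_intros GDERIV_line[OF h] refl)+ simp
    have "e \<bullet> (dh (u + t *\<^sub>R e) - dh u) \<le> norm e * norm (dh (u + t *\<^sub>R e) - dh u)"
      by (rule norm_cauchy_schwarz)
    also have "\<dots> \<le> norm e * (L * norm (t *\<^sub>R e))"
      using lipschitz_onD[OF L, of "u + t *\<^sub>R e" u] by (intro mult_left_mono) (auto simp: dist_norm)
    finally show "e \<bullet> dh (u + t *\<^sub>R e) - e \<bullet> dh u - L * t * (norm e)\<^sup>2 \<le> 0"
      using that by (simp add: inner_diff_right power2_eq_square mult_ac)
  qed
  then have "\<psi> 1 \<le> \<psi> 0" by (rule DERIV_nonpos_imp_nonincreasing[of 0 1 \<psi>, OF zero_le_one])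
  then show ?thesis by (simp add: \<psi>_def e_def)
qed

text \<open>Baillon--Haddad, multiplied by \<open>L\<close> so that \<open>L = 0\<close> is covered.\<close>

lemma gradient_cocoercive:
  fixes h :: "'a::real_inner \<Rightarrow> real"
  assumes h: "convex_on UNIV h" "\<And>u. GDERIV h u :> dh u" and L: "0 \<le> L" "L-lipschitz_on UNIV dh"
  shows "(norm (dh a - dh b))\<^sup>2 \<le> L * ((dh a - dh b) \<bullet> (a - b))"
proof (cases "L = 0")
  case True
  then show ?thesis using lipschitz_onD[OF L(2), of a b] by (simp add: dist_norm)
next
  case False
  with L(1) have "0 < L" by simp
  have half: "(norm (dh a - dh b))\<^sup>2 \<le> 2 * L * (h b - h a - (b - a) \<bullet> dh a)" for a b
  proof -
    \<comment> \<open>A gradient step of length \<open>1 / L\<close> from \<open>b\<close> for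
      \<open>h\<close> tilted by \<open>dh a\<close>, a function minimal at \<open>a\<close>. Its
      value at \<open>w\<close> is bounded below by convexity at \<open>a\<close> and above by the
      descent lemma at \<open>b\<close>.\<close>
    define w where "w = b - (1 / L) *\<^sub>R (dh b - dh a)"
    have "h a + (w - a) \<bullet> dh a \<le> h w" by (rule convex_on_gradient[OF h])
    also have "\<dots> \<le> h b + (w - b) \<bullet> dh b + L / 2 * (norm (w - b))\<^sup>2"
      by (rule descent_lemma[OF h(2) L(2)])
    also have "(norm (w - b))\<^sup>2 = (norm (dh b - dh a))\<^sup>2 / L\<^sup>2"
      using \<open>0 < L\<close> by (simp add: w_def power_divide)
    finally have "h a + (w - a) \<bullet> dh a \<le> h b + (w - b) \<bullet> dh b + (norm (dh b - dh a))\<^sup>2 / (2 * L)"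
      using \<open>0 < L\<close> by (simp add: power2_eq_square)
    moreover have "(w - b) \<bullet> dh b - (w - a) \<bullet> dh a = - (norm (dh b - dh a))\<^sup>2 / L - (b - a) \<bullet> dh a"
      using \<open>0 < L\<close> unfolding w_def power2_norm_eq_inner
      by (simp add: inner_diff_left inner_diff_right inner_add_left inner_add_right inner_commute
          field_simps)
    ultimately have "(norm (dh b - dh a))\<^sup>2 / (2 * L) \<le> h b - h a - (b - a) \<bullet> dh a"
      using \<open>0 < L\<close> by (simp add: field_simps)
    then show ?thesis using \<open>0 < L\<close> by (simp add: field_simps norm_minus_commute)
  qed
  \<comment> \<open>Adding \<open>half\<close> to its copy with \<open>a\<close> and
    \<open>b\<close> exchanged cancels the values of \<open>h\<close>.\<close>
  have "2 * (norm (dh a - dh b))\<^sup>2 \<le>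
      2 * L * ((h b - h a - (b - a) \<bullet> dh a) + (h a - h b - (a - b) \<bullet> dh b))"
    using half[of a b] half[of b a] by (simp add: norm_minus_commute algebra_simps)
  also have "\<dots> = 2 * (L * ((dh a - dh b) \<bullet> (a - b)))"
    by (simp add: inner_diff_left inner_diff_right inner_commute algebra_simps)
  finally show ?thesis by simp
qed

text \<open>Cocoercivity pays for the squared gradient difference that arises from completing a
  square. Doubled in the Lyapunov estimate, the constant \<open>L / 4\<close> becomes the
  \<open>L / 2\<close> subtracted from \<open>M1\<close>.\<close>

lemma gradient_three_point:
  fixes h :: "'a::real_inner \<Rightarrow> real"
  assumes h: "convex_on UNIV h" "\<And>u. GDERIV h u :> dh u" and L: "0 \<le> L" "L-lipschitz_on UNIV dh"
  shows "(dh a - dh b) \<bullet> (b - c) \<le> L / 4 * (norm (a - c))\<^sup>2"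
proof (cases "L = 0")
  case True
  then show ?thesis using lipschitz_onD[OF L(2), of a b] by (simp add: dist_norm)
next
  case False
  with L(1) have "0 < L" by simp
  define d where "d = dh a - dh b"
  have "0 \<le> (norm (d - (L / 2) *\<^sub>R (a - c)))\<^sup>2" by simp
  also have "\<dots> = (norm d)\<^sup>2 - L * (d \<bullet> (a - c)) + L\<^sup>2 / 4 * (norm (a - c))\<^sup>2"
    unfolding power2_norm_eq_inner
    by (simp add: inner_diff_left inner_diff_right inner_add_left inner_add_right inner_commute
        field_simps power2_eq_square)
  also have "\<dots> \<le> L * (d \<bullet> (a - b)) - L * (d \<bullet> (a - c)) + L\<^sup>2 / 4 * (norm (a - c))\<^sup>2"
    using gradient_cocoercive[OF h L, of a b] by (simp add: d_def)
  finally have "L * (d \<bullet> (b - c)) \<le> L * (L / 4 * (norm (a - c))\<^sup>2)"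
    by (simp add: inner_diff_right algebra_simps power2_eq_square)
  then show ?thesis using \<open>0 < L\<close> by (simp add: d_def)
qed

subsection \<open>The iteration\<close>

lemma sufficient_decrease:
  fixes a b :: "nat \<Rightarrow> real"
  assumes "\<And>k. 0 \<le> a k" "\<And>k. 0 \<le> b k" "\<And>k. a (Suc k) \<le> a k - b k"
  shows "convergent a" "b \<longlonglongrightarrow> 0"
proof -
  have "a (Suc k) \<le> a k" for k using assms(2)[of k] assms(3)[of k] by linarith
  then have "decseq a" by (rule decseq_SucI)
  then obtain l where l: "a \<longlonglongrightarrow> l" using decseq_convergent assms(1) by blast
  then show "convergent a" by (rule convergentI)
  have "(\<lambda>k. a k - a (Suc k)) \<longlonglongrightarrow> l - l" by (intro tendsto_diff l LIMSEQ_Suc)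
  moreover have "b k \<le> a k - a (Suc k)" for k using assms(3)[of k] by linarith
  ultimately show "b \<longlonglongrightarrow> 0"
    using tendsto_sandwich[of "\<lambda>_. 0" b sequentially "\<lambda>k. a k - a (Suc k)" 0] assms(2) by simp
qed

lemma null_if_dominated:
  fixes u :: "nat \<Rightarrow> 'a::real_normed_vector"
  assumes "0 < \<alpha>" "\<And>k. \<alpha> * (norm (u k))\<^sup>2 \<le> b k" "b \<longlonglongrightarrow> 0"
  shows "u \<longlonglongrightarrow> 0"
proof -
  have "(\<lambda>k. b k / \<alpha>) \<longlonglongrightarrow> 0 / \<alpha>" by (intro tendsto_intros assms(3)) (use assms(1) in simp)
  moreover have "(norm (u k))\<^sup>2 \<le> b k / \<alpha>" for k
    using assms(1) assms(2)[of k] by (simp add: field_simps)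
  ultimately have "(\<lambda>k. (norm (u k))\<^sup>2) \<longlonglongrightarrow> 0"
    using tendsto_sandwich[of "\<lambda>_. 0" "\<lambda>k. (norm (u k))\<^sup>2" sequentially "\<lambda>k. b k / \<alpha>" 0] by simp
  from tendsto_real_sqrt[OF this] show ?thesis by (simp add: tendsto_norm_zero_iff)
qed

text \<open>Collects the standing hypotheses; a saddle point and the consequences of the three
  alternatives enter as explicit premises of the lemmas that use them.\<close>

locale vm_admm_iteration =
  fixes f :: "'h::{real_inner, complete_space} \<Rightarrow> ereal"
    and g :: "'g::{real_inner, complete_space} \<Rightarrow> ereal"
    and h :: "'h \<Rightarrow> real" and dh :: "'h \<Rightarrow> 'h" and L c :: real
    and A :: "'h \<Rightarrow> 'g"
    and M1 :: "nat \<Rightarrow> 'h \<Rightarrow> 'h" and M2 :: "nat \<Rightarrow> 'g \<Rightarrow> 'g"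
    and x :: "nat \<Rightarrow> 'h" and z y :: "nat \<Rightarrow> 'g"
  assumes f: "proper_fun f" "convex_fun f" "lsc_fun f"
    and g: "proper_fun g" "convex_fun g" "lsc_fun g"
    and h: "convex_on UNIV h" "\<And>u. GDERIV h u :> dh u"
    and L: "0 \<le> L" "L-lipschitz_on UNIV dh"
    and A: "bounded_linear A"
    and c: "0 < c"
    and M: "\<And>k. M1 k \<in> S_plus" "\<And>k. M2 k \<in> S_plus"
      "\<And>k. (\<lambda>u. M1 k u - (L / 2) *\<^sub>R u) \<in> S_plus"
      "\<And>k. M1 k \<succcurlyeq> M1 (Suc k)" "\<And>k. M2 k \<succcurlyeq> M2 (Suc k)"
    and admm: "vm_admm f g dh A c M1 M2 x z y"
begin

abbreviation "saddle \<equiv> saddle_point (Lagrangian f h g A)"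

definition "dx k = x (Suc k) - x k"
definition "dz k = z (Suc k) - z k"
definition "dy k = y (Suc k) - y k"

lemmas A_lin = linear_simps[OF A]

section \<open>Optimality conditions at saddle points\<close>

lemma saddle_finite:
  assumes "saddle (x', z', y')"
  shows "\<bar>f x'\<bar> \<noteq> \<infinity>" "\<bar>g z'\<bar> \<noteq> \<infinity>"
proof -
  obtain v w where vw: "f v \<noteq> \<infinity>" "g w \<noteq> \<infinity>" using f(1) g(1) by (auto simp: proper_fun_def)
  have "Lagrangian f h g A x' z' y' \<le> Lagrangian f h g A v w y'"
    using assms by (auto simp: saddle_point_def)
  moreover have "f v \<noteq> -\<infinity>" "g w \<noteq> -\<infinity>" "f x' \<noteq> -\<infinity>" "g z' \<noteq> -\<infinity>"
    using f(1) g(1) by (auto simp: proper_fun_def)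
  ultimately show "\<bar>f x'\<bar> \<noteq> \<infinity>" "\<bar>g z'\<bar> \<noteq> \<infinity>"
    using vw unfolding Lagrangian_def
    by (cases "f v"; cases "g w"; cases "f x'"; cases "g z'"; simp)+
qed

text \<open>Moving the multiplier in the direction of the residual would raise the Lagrangian by its
  squared norm.\<close>

lemma saddle_feasible:
  assumes "saddle (x', z', y')"
  shows "z' = A x'"
proof -
  have "Lagrangian f h g A x' z' (y' + (A x' - z')) \<le> Lagrangian f h g A x' z' y'"
    using assms by (auto simp: saddle_point_def)
  with saddle_finite[OF assms] have "(A x' - z') \<bullet> (A x' - z') \<le> 0"
    unfolding Lagrangian_def inner_add_left by auto
  then have "(A x' - z') \<bullet> (A x' - z') = 0" by (intro antisym) simp_all
  then show ?thesis by simp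
qed

text \<open>\<open>x'\<close> minimizes \<open>f\<close> plus the smooth function
  \<open>h v + y' \<bullet> A v\<close>; the descent lemma provides the quadratic model of the
  latter.\<close>

lemma saddle_subgradient_f:
  assumes "saddle (x', z', y')"
  shows "f x' \<le> f v + ereal ((v - x') \<bullet> dh x' + y' \<bullet> A (v - x'))"
proof (rule argmin_variational[OF f(1,2), where q = "\<lambda>v. h v + y' \<bullet> A v" and K = "L / 2 * (norm (v - x'))\<^sup>2"])
  have "f x' + ereal (h x' + y' \<bullet> A x') \<le> f v + ereal (h v + y' \<bullet> A v)" for v
  proof -
    have "Lagrangian f h g A x' z' y' \<le> Lagrangian f h g A v z' y'"
      using assms by (auto simp: saddle_point_def)
    then show ?thesis
      using saddle_finite[OF assms] unfolding Lagrangian_def inner_diff_right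
      by (cases "f v") (auto simp: algebra_simps)
  qed
  then show "x' \<in> argmin (\<lambda>v. f v + ereal (h v + y' \<bullet> A v))" by (simp add: argmin_iff)
  fix t :: real assume "0 < t" "t < 1"
  show "h (x' + t *\<^sub>R (v - x')) + y' \<bullet> A (x' + t *\<^sub>R (v - x'))
       \<le> h x' + y' \<bullet> A x' + t * ((v - x') \<bullet> dh x' + y' \<bullet> A (v - x')) + t\<^sup>2 * (L / 2 * (norm (v - x'))\<^sup>2)"
    using descent_lemma[OF h(2) L(2), of "x' + t *\<^sub>R (v - x')" x']
    unfolding A_lin by (simp add: inner_add_right power_mult_distrib distrib_left mult_ac)
qed

lemma saddle_subgradient_g:
  assumes "saddle (x', z', y')"
  shows "g z' \<le> g w + ereal (- (y' \<bullet> (w - z')))"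
proof (rule argmin_variational[OF g(1,2), where q = "\<lambda>w. - (y' \<bullet> w)" and K = 0])
  have "g z' + ereal (- (y' \<bullet> z')) \<le> g w + ereal (- (y' \<bullet> w))" for w
  proof -
    have "Lagrangian f h g A x' z' y' \<le> Lagrangian f h g A x' w y'"
      using assms by (auto simp: saddle_point_def)
    then show ?thesis
      using saddle_finite[OF assms] unfolding Lagrangian_def inner_diff_right
      by (cases "g w") (auto simp: algebra_simps)
  qed
  then show "z' \<in> argmin (\<lambda>w. g w + ereal (- (y' \<bullet> w)))" by (simp add: argmin_iff)
qed (simp add: inner_add_right)

text \<open>Feasibility makes the Lagrangian at \<open>(x', z')\<close> independent of the
  multiplier, so only minimality in the primal variables remains.\<close>

lemma saddleI:
  assumes "z' = A x'" "\<bar>f x'\<bar> \<noteq> \<infinity>" "\<bar>g z'\<bar> \<noteq> \<infinity>"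
    and "\<And>v w. f x' + g z' \<le> f v + g w + ereal (h v - h x' + y' \<bullet> (A v - w))"
  shows "saddle (x', z', y')"
proof -
  have "Lagrangian f h g A x' z' y' \<le> Lagrangian f h g A v w y'" for v w
    using assms(4)[of v w] assms(1-3) unfolding Lagrangian_def
    by (cases "f v"; cases "g w") (auto simp: algebra_simps)
  moreover have "Lagrangian f h g A x' z' u \<le> Lagrangian f h g A x' z' y'" for u
    using assms(1) by (simp add: Lagrangian_def)
  ultimately show ?thesis by (simp add: saddle_point_def)
qed

section \<open>Optimality conditions of the two subproblems\<close>

lemma dy_eq: "dy k = c *\<^sub>R (A (x (Suc k)) - z (Suc k))"
  using admm by (simp add: vm_admm_def dy_def)

lemma A_x_Suc: "A (x (Suc k)) = z (Suc k) + (1 / c) *\<^sub>R dy k"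
  using c by (simp add: dy_eq)

lemma x_argmin: "x (Suc k) \<in> argmin (\<lambda>u. f u + ereal ((u - x k) \<bullet> dh (x k)
         + c / 2 * (norm (A u - z k + inverse c *\<^sub>R y k))\<^sup>2
         + 1 / 2 * sqnorm_op (M1 k) (u - x k)))"
  using admm by (simp add: vm_admm_def)

lemma z_argmin: "z (Suc k) \<in> argmin (\<lambda>w. g w + ereal (c / 2 * (norm (A (x (Suc k)) - w + inverse c *\<^sub>R y k))\<^sup>2
         + 1 / 2 * sqnorm_op (M2 k) (w - z k)))"
  using admm unfolding vm_admm_def by blast

lemma iterates_finite: "\<bar>f (x (Suc k))\<bar> \<noteq> \<infinity>" "\<bar>g (z (Suc k))\<bar> \<noteq> \<infinity>"
  by (rule argmin_finite[OF f(1) x_argmin], rule argmin_finite[OF g(1) z_argmin])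

text \<open>The penalty contains the old \<open>z k\<close>, so its gradient yields the new
  multiplier shifted by \<open>c *\<^sub>R dz k\<close>.\<close>

lemma x_subgradient:
  "f (x (Suc k)) \<le> f v + ereal ((v - x (Suc k)) \<bullet> dh (x k)
     + (y (Suc k) + c *\<^sub>R dz k) \<bullet> A (v - x (Suc k)) + (v - x (Suc k)) \<bullet> M1 k (dx k))"
proof (rule argmin_variational[OF f(1,2) x_argmin,
    where K = "c / 2 * (norm (A (v - x (Suc k))))\<^sup>2 + 1 / 2 * sqnorm_op (M1 k) (v - x (Suc k))"])
  fix t :: real
  define e where "e = v - x (Suc k)"
  define b where "b = A (x (Suc k)) - z k + inverse c *\<^sub>R y k"
  have cb: "y (Suc k) + c *\<^sub>R dz k = c *\<^sub>R b"
    using dy_eq[of k] c by (simp add: b_def dy_def dz_def algebra_simps)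
  have eqs: "A (x (Suc k) + t *\<^sub>R e) - z k + inverse c *\<^sub>R y k = b + t *\<^sub>R A e"
    "x (Suc k) + t *\<^sub>R e - x k = dx k + t *\<^sub>R e" by (simp_all add: b_def A_lin dx_def)
  show "(x (Suc k) + t *\<^sub>R (v - x (Suc k)) - x k) \<bullet> dh (x k)
      + c / 2 * (norm (A (x (Suc k) + t *\<^sub>R (v - x (Suc k))) - z k + inverse c *\<^sub>R y k))\<^sup>2
      + 1 / 2 * sqnorm_op (M1 k) (x (Suc k) + t *\<^sub>R (v - x (Suc k)) - x k)
    \<le> (x (Suc k) - x k) \<bullet> dh (x k) + c / 2 * (norm (A (x (Suc k)) - z k + inverse c *\<^sub>R y k))\<^sup>2
      + 1 / 2 * sqnorm_op (M1 k) (x (Suc k) - x k)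
      + t * ((v - x (Suc k)) \<bullet> dh (x k)
        + (y (Suc k) + c *\<^sub>R dz k) \<bullet> A (v - x (Suc k)) + (v - x (Suc k)) \<bullet> M1 k (dx k))
      + t\<^sup>2 * (c / 2 * (norm (A (v - x (Suc k))))\<^sup>2 + 1 / 2 * sqnorm_op (M1 k) (v - x (Suc k)))"
    unfolding e_def[symmetric] eqs b_def[symmetric] dx_def[symmetric] cb norm_add_scaleR
      sqnorm_op_add_scaleR[OF M(1)]
    by (simp add: inner_add_left field_simps)
qed

text \<open>Here the penalty gradient is exactly the updated multiplier, so the inequality says that
  \<open>y (Suc k) - M2 k (dz k)\<close> is a subgradient of \<open>g\<close> at
  \<open>z (Suc k)\<close>.\<close>

lemma z_subgradient:
  "g (z (Suc k)) \<le> g w + ereal (- (y (Suc k) \<bullet> (w - z (Suc k))) + (w - z (Suc k)) \<bullet> M2 k (dz k))"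
proof (rule argmin_variational[OF g(1,2) z_argmin,
    where K = "c / 2 * (norm (w - z (Suc k)))\<^sup>2 + 1 / 2 * sqnorm_op (M2 k) (w - z (Suc k))"])
  fix t :: real
  define e where "e = w - z (Suc k)"
  define b where "b = A (x (Suc k)) - z (Suc k) + inverse c *\<^sub>R y k"
  have cb: "y (Suc k) = c *\<^sub>R b"
    using dy_eq[of k] c by (simp add: b_def dy_def algebra_simps)
  have eqs: "A (x (Suc k)) - (z (Suc k) + t *\<^sub>R e) + inverse c *\<^sub>R y k = b + (- t) *\<^sub>R e"
    "z (Suc k) + t *\<^sub>R e - z k = dz k + t *\<^sub>R e" by (simp_all add: b_def dz_def)
  show "c / 2 * (norm (A (x (Suc k)) - (z (Suc k) + t *\<^sub>R (w - z (Suc k))) + inverse c *\<^sub>R y k))\<^sup>2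
      + 1 / 2 * sqnorm_op (M2 k) (z (Suc k) + t *\<^sub>R (w - z (Suc k)) - z k)
    \<le> c / 2 * (norm (A (x (Suc k)) - z (Suc k) + inverse c *\<^sub>R y k))\<^sup>2
      + 1 / 2 * sqnorm_op (M2 k) (z (Suc k) - z k)
      + t * (- (y (Suc k) \<bullet> (w - z (Suc k))) + (w - z (Suc k)) \<bullet> M2 k (dz k))
      + t\<^sup>2 * (c / 2 * (norm (w - z (Suc k)))\<^sup>2 + 1 / 2 * sqnorm_op (M2 k) (w - z (Suc k)))"
    unfolding e_def[symmetric] eqs b_def[symmetric] dz_def[symmetric] cb norm_add_scaleR
      sqnorm_op_add_scaleR[OF M(2)]
    by (simp add: field_simps)
qed

section \<open>Decrease of the Lyapunov function and vanishing residuals\<close>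

definition lyapunov :: "'h \<Rightarrow> 'g \<Rightarrow> 'g \<Rightarrow> nat \<Rightarrow> real" where
  "lyapunov x' z' y' k = sqnorm_op (M1 k) (x k - x') + sqnorm_op (M2 k) (z k - z')
     + c * (norm (z k - z'))\<^sup>2 + (norm (y k - y'))\<^sup>2 / c"

lemma lyapunov_nonneg: "0 \<le> lyapunov x' z' y' k"
  using S_plusD(3)[OF M(1)] S_plusD(3)[OF M(2)] c by (auto simp: lyapunov_def)

text \<open>The cross term \<open>dz k \<bullet> dy k\<close> is left open because it is treated in
  two ways: \<open>residual_limits\<close> completes the square, while
  \<open>dz_null_if_M2_halving\<close> estimates it by monotonicity.\<close>

lemma lyapunov_decrease:
  assumes "saddle (x', z', y')"
  shows "lyapunov x' z' y' (Suc k) \<le> lyapunov x' z' y' k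
    - (sqnorm_op (M1 k) (dx k) - L / 2 * (norm (dx k))\<^sup>2) - sqnorm_op (M2 k) (dz k)
    - c * (norm (dz k))\<^sup>2 - (norm (dy k))\<^sup>2 / c - 2 * (dz k \<bullet> dy k)"
proof -
  let ?x = "x (Suc k)" and ?z = "z (Suc k)" and ?y = "y (Suc k)"
  note fin = saddle_finite[OF assms] iterates_finite[of k]
  \<comment> \<open>The inequality of the subproblem, tested at \<open>x'\<close>, is added to that
    of the saddle point, tested at the new iterate; the finite values of \<open>f\<close> cancel.
    The same is done for \<open>g\<close> next.\<close>
  have "0 \<le> (x' - ?x) \<bullet> dh (x k) + (?y + c *\<^sub>R dz k) \<bullet> A (x' - ?x) + (x' - ?x) \<bullet> M1 k (dx k)
      + ((?x - x') \<bullet> dh x' + y' \<bullet> A (?x - x'))"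
    using x_subgradient[of k x'] saddle_subgradient_f[OF assms, of ?x] fin by auto
  moreover have "0 \<le> - (?y \<bullet> (z' - ?z)) + (z' - ?z) \<bullet> M2 k (dz k) + - (y' \<bullet> (?z - z'))"
    using z_subgradient[of k z'] saddle_subgradient_g[OF assms, of ?z] fin by auto
  moreover have "A (x' - ?x) = z' - ?z - (1 / c) *\<^sub>R dy k" "A (?x - x') = - (z' - ?z - (1 / c) *\<^sub>R dy k)"
    using saddle_feasible[OF assms] by (simp_all add: A_lin A_x_Suc)
  moreover have "(x' - ?x) \<bullet> dh (x k) + (?x - x') \<bullet> dh x' = (dh (x k) - dh x') \<bullet> (x' - ?x)"
    by (simp add: inner_diff_left inner_diff_right inner_commute)
  moreover have "(dh (x k) - dh x') \<bullet> (x' - ?x) \<le> L / 4 * (norm (dx k))\<^sup>2"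
    using gradient_three_point[OF h L, of "x k" x' ?x] by (simp add: dx_def norm_minus_commute)
  \<comment> \<open>Once \<open>A\<close> is eliminated by feasibility and the multiplier update,
    the multiplier terms reduce to two three-point products and the cross term.\<close>
  moreover have "(?y + c *\<^sub>R dz k) \<bullet> (z' - ?z - (1 / c) *\<^sub>R dy k) + y' \<bullet> (- (z' - ?z - (1 / c) *\<^sub>R dy k))
      - ?y \<bullet> (z' - ?z) - y' \<bullet> (?z - z')
      = c * ((z' - ?z) \<bullet> dz k) + (y' - ?y) \<bullet> dy k / c - dz k \<bullet> dy k"
    using c by (simp add: inner_add_left inner_add_right inner_diff_right inner_diff_left inner_commute
        field_simps)
  moreover have "2 * ((x' - ?x) \<bullet> M1 k (dx k)) =
      sqnorm_op (M1 k) (x k - x') - sqnorm_op (M1 k) (?x - x') - sqnorm_op (M1 k) (dx k)"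
    unfolding dx_def by (rule S_plus_three_point[OF M(1)])
  moreover have "2 * ((z' - ?z) \<bullet> M2 k (dz k)) =
      sqnorm_op (M2 k) (z k - z') - sqnorm_op (M2 k) (?z - z') - sqnorm_op (M2 k) (dz k)"
    unfolding dz_def by (rule S_plus_three_point[OF M(2)])
  moreover have "2 * (c * ((z' - ?z) \<bullet> dz k)) =
      c * (norm (z k - z'))\<^sup>2 - c * (norm (?z - z'))\<^sup>2 - c * (norm (dz k))\<^sup>2"
    using inner_three_point[of z' ?z "z k"] by (simp add: dz_def flip: right_diff_distrib)
  moreover have "2 * ((y' - ?y) \<bullet> dy k / c) =
      (norm (y k - y'))\<^sup>2 / c - (norm (?y - y'))\<^sup>2 / c - (norm (dy k))\<^sup>2 / c"
    using inner_three_point[of y' ?y "y k"] by (simp add: dy_def flip: diff_divide_distrib)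
  \<comment> \<open>The three-point identities measure the new distances in the old metric;
    monotonicity passes to the new one.\<close>
  moreover have "sqnorm_op (M1 (Suc k)) (?x - x') \<le> sqnorm_op (M1 k) (?x - x')"
    "sqnorm_op (M2 (Suc k)) (?z - z') \<le> sqnorm_op (M2 k) (?z - z')"
    using M(4,5) by (auto simp: op_ge_def)
  ultimately show ?thesis unfolding lyapunov_def by simp
qed

text \<open>Monotonicity of the subdifferential of \<open>g\<close> between \<open>z (Suc k)\<close>
  and \<open>z (Suc (Suc k))\<close>, for the subgradients given by
  \<open>z_subgradient\<close>.\<close>

lemma dz_monotone:
  "dz (Suc k) \<bullet> M2 (Suc k) (dz (Suc k)) \<le> dz (Suc k) \<bullet> dy (Suc k) + dz (Suc k) \<bullet> M2 k (dz k)"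
proof -
  let ?z = "z (Suc k)" and ?w = "z (Suc (Suc k))"
  have "0 \<le> - (y (Suc (Suc k)) \<bullet> (?z - ?w)) + (?z - ?w) \<bullet> M2 (Suc k) (dz (Suc k))
      - y (Suc k) \<bullet> (?w - ?z) + (?w - ?z) \<bullet> M2 k (dz k)"
    using z_subgradient[of "Suc k" ?z] z_subgradient[of k ?w] iterates_finite(2)[of k]
      iterates_finite(2)[of "Suc k"] by auto
  moreover have "?z - ?w = - dz (Suc k)" "?w - ?z = dz (Suc k)" by (simp_all add: dz_def)
  ultimately show ?thesis by (simp add: dy_def inner_diff_right inner_commute)
qed

lemma M1_excess: "0 \<le> sqnorm_op (M1 k) u - L / 2 * (norm u)\<^sup>2"
  using S_plusD(3)[OF M(3), of k u] by (simp add: sqnorm_op_def inner_diff_right power2_norm_eq_inner)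

lemma A_x_Suc_minus_z: "A (x (Suc k)) - z k = dz k + (1 / c) *\<^sub>R dy k"
  by (simp add: A_x_Suc dz_def)

lemma residual_limits:
  assumes "saddle (x', z', y')"
  shows "convergent (lyapunov x' z' y')"
    and "(\<lambda>k. sqnorm_op (M1 k) (dx k) - L / 2 * (norm (dx k))\<^sup>2) \<longlonglongrightarrow> 0"
    and "(\<lambda>k. sqnorm_op (M2 k) (dz k)) \<longlonglongrightarrow> 0"
    and "(\<lambda>k. A (x (Suc k)) - z k) \<longlonglongrightarrow> 0"
proof -
  define r where "r k = (sqnorm_op (M1 k) (dx k) - L / 2 * (norm (dx k))\<^sup>2) + sqnorm_op (M2 k) (dz k)
     + c * (norm (A (x (Suc k)) - z k))\<^sup>2" for k
  note nn = M1_excess S_plusD(3)[OF M(2)] mult_nonneg_nonneg[OF less_imp_le[OF c] zero_le_power2]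
  have r_nonneg: "0 \<le> r k" for k unfolding r_def by (intro add_nonneg_nonneg nn)
  \<comment> \<open>Completing the square absorbs the cross term, so that \<open>r k\<close> is a
    sum of three nonnegative parts.\<close>
  have "c * (norm (A (x (Suc k)) - z k))\<^sup>2 = c * (norm (dz k))\<^sup>2 + (norm (dy k))\<^sup>2 / c + 2 * (dz k \<bullet> dy k)" for k
    unfolding A_x_Suc_minus_z norm_add_scaleR using c by (simp add: field_simps power2_eq_square)
  then have "lyapunov x' z' y' (Suc k) \<le> lyapunov x' z' y' k - r k" for k
    using lyapunov_decrease[OF assms, of k] unfolding r_def by simp
  note dec = sufficient_decrease[of "lyapunov x' z' y'", OF lyapunov_nonneg r_nonneg this]
  show "convergent (lyapunov x' z' y')" by (rule dec(1))
  have null: "b \<longlonglongrightarrow> 0" if "\<And>k. 0 \<le> b k" "\<And>k. b k \<le> r k" for b :: "nat \<Rightarrow> real"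
    using tendsto_sandwich[of "\<lambda>_. 0" b sequentially r 0] that dec(2) by simp
  show "(\<lambda>k. sqnorm_op (M1 k) (dx k) - L / 2 * (norm (dx k))\<^sup>2) \<longlonglongrightarrow> 0"
    by (rule null, rule nn(1)) (use add_nonneg_nonneg[OF nn(2,3)] in \<open>simp add: r_def add.assoc\<close>)
  show "(\<lambda>k. sqnorm_op (M2 k) (dz k)) \<longlonglongrightarrow> 0"
    by (rule null, rule nn(2)) (use add_nonneg_nonneg[OF nn(1,3)] in \<open>simp add: r_def algebra_simps\<close>)
  have "c * (norm (A (x (Suc k)) - z k))\<^sup>2 \<le> r k" for k
    unfolding r_def using nn(1)[of k "dx k"] nn(2)[of k "dz k"] by linarith
  from null_if_dominated[OF c this dec(2)]
  show "(\<lambda>k. A (x (Suc k)) - z k) \<longlonglongrightarrow> 0" .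
qed

section \<open>Vanishing of \<open>dz\<close> under each of the three assumptions\<close>

lemma dz_null_if_M1_coercive:
  assumes "saddle (x', z', y')" "0 < \<alpha>"
    and "\<And>k u. \<alpha> * (norm u)\<^sup>2 \<le> sqnorm_op (M1 k) u - L / 2 * (norm u)\<^sup>2"
  shows "dz \<longlonglongrightarrow> 0"
proof -
  have "dx \<longlonglongrightarrow> 0"
    using null_if_dominated[OF assms(2) assms(3) residual_limits(2)[OF assms(1)]] .
  then have "(\<lambda>k. A (dx (Suc k))) \<longlonglongrightarrow> A 0"
    by (intro bounded_linear.tendsto[OF A] LIMSEQ_Suc)
  \<comment> \<open>Coercivity gives \<open>dx \<longlonglongrightarrow> 0\<close>; the difference
    of two consecutive residuals then recovers \<open>dz k\<close> from
    \<open>A (dx (Suc k))\<close>.\<close>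
  then have "(\<lambda>k. A (dx (Suc k)) - (A (x (Suc (Suc k))) - z (Suc k)) + (A (x (Suc k)) - z k)) \<longlonglongrightarrow> 0 - 0 + 0"
    by (intro tendsto_add tendsto_diff LIMSEQ_Suc[OF residual_limits(4)[OF assms(1)]]
        residual_limits(4)[OF assms(1)]) (simp add: A_lin)
  moreover have "A (dx (Suc k)) - (A (x (Suc (Suc k))) - z (Suc k)) + (A (x (Suc k)) - z k) = dz k" for k
    by (simp add: dx_def dz_def A_lin)
  ultimately show ?thesis by simp
qed

lemma dz_null_if_M2_coercive:
  assumes "saddle (x', z', y')" "0 < \<alpha>" "\<And>k u. \<alpha> * (norm u)\<^sup>2 \<le> sqnorm_op (M2 k) u"
  shows "dz \<longlonglongrightarrow> 0"
  using null_if_dominated[OF assms(2) assms(3) residual_limits(3)[OF assms(1)]] .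

text \<open>
  Monotonicity of \<open>\<partial>g\<close> along two consecutive steps bounds the cross term \<open>- 2 (dz \<bullet> dy)\<close> by the
  previous \<open>\<parallel>dz\<parallel>\<^sup>2\<close> in the metric \<open>M2\<close>, which is therefore added to the Lyapunov function.
\<close>

lemma dz_null_if_M2_halving:
  assumes "saddle (x', z', y')" "\<And>k u. sqnorm_op (M2 k) u \<le> 2 * sqnorm_op (M2 (Suc k)) u"
  shows "dz \<longlonglongrightarrow> 0"
proof -
  \<comment> \<open>The index is shifted so that the step from \<open>Suc k\<close> may spend the
    stored term of step \<open>k\<close>.\<close>
  define W where "W k = lyapunov x' z' y' (Suc k) + sqnorm_op (M2 k) (dz k)" for k
  have "W (Suc k) \<le> W k - c * (norm (dz (Suc k)))\<^sup>2" for k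
  proof -
    have "0 \<le> sqnorm_op (M2 k) (dz (Suc k) - dz k)" by (rule S_plusD(3)[OF M(2)])
    then have "2 * (dz (Suc k) \<bullet> M2 k (dz k)) \<le> sqnorm_op (M2 k) (dz (Suc k)) + sqnorm_op (M2 k) (dz k)"
      unfolding sqnorm_op_diff[OF M(2)] by simp
    moreover have "sqnorm_op (M2 (Suc k)) (dz (Suc k)) \<le> dz (Suc k) \<bullet> dy (Suc k) + dz (Suc k) \<bullet> M2 k (dz k)"
      using dz_monotone[of k] by (simp add: sqnorm_op_def)
    \<comment> \<open>The factor 2 of the halving condition matches exactly: the seminorms of
      \<open>dz (Suc k)\<close> cancel.\<close>
    ultimately have "- 2 * (dz (Suc k) \<bullet> dy (Suc k)) \<le> sqnorm_op (M2 k) (dz k)"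
      using assms(2)[of k "dz (Suc k)"] by linarith
    moreover have "0 \<le> (norm (dy (Suc k)))\<^sup>2 / c" using c by simp
    ultimately show ?thesis
      using lyapunov_decrease[OF assms(1), of "Suc k"] M1_excess[of "Suc k" "dx (Suc k)"]
      unfolding W_def by linarith
  qed
  from sufficient_decrease(2)[of W, OF _ _ this]
  have "(\<lambda>k. c * (norm (dz (Suc k)))\<^sup>2) \<longlonglongrightarrow> 0"
    using lyapunov_nonneg S_plusD(3)[OF M(2)] c by (simp add: W_def)
  from null_if_dominated[OF c order_refl this] show ?thesis by (rule LIMSEQ_imp_Suc)
qed

text \<open>The sum of the two subgradient inequalities passes to the limit: the left side by weak
  lower semicontinuity, the right side because every product left in \<open>R\<close> pairs a
  bounded sequence with a null one, or a weakly convergent one with a fixed vector.\<close>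

lemma cluster_point_saddle:
  assumes null: "dx \<longlonglongrightarrow> 0" "dz \<longlonglongrightarrow> 0" "dy \<longlonglongrightarrow> 0"
    and bdd: "bounded (range x)" "bounded (range z)" "bounded (range y)"
    and r: "strict_mono r"
    and lim: "weakly_tendsto (\<lambda>n. x (r n)) x'" "weakly_tendsto (\<lambda>n. z (r n)) z'"
      "weakly_tendsto (\<lambda>n. y (r n)) y'"
  shows "saddle (x', z', y')"
proof -
  \<comment> \<open>The subgradient inequalities hold at the iterates following the subsequence;
    these have the same weak limits since the increments vanish.\<close>
  define X Z Y where "X n = x (Suc (r n))" and "Z n = z (Suc (r n))" and "Y n = y (Suc (r n))" for n
  have sub: "(\<lambda>n. dx (r n)) \<longlonglongrightarrow> 0" "(\<lambda>n. dz (r n)) \<longlonglongrightarrow> 0" "(\<lambda>n. dy (r n)) \<longlonglongrightarrow> 0"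
    using null[THEN LIMSEQ_subseq_LIMSEQ, OF r] by (simp_all add: comp_def)
  have X: "weakly_tendsto X x'" and Z: "weakly_tendsto Z z'" and Y: "weakly_tendsto Y y'"
    using weakly_tendsto_add_null[OF lim(1) sub(1)] weakly_tendsto_add_null[OF lim(2) sub(2)]
      weakly_tendsto_add_null[OF lim(3) sub(3)]
    by (simp_all add: X_def[abs_def] Z_def[abs_def] Y_def[abs_def] dx_def dz_def dy_def)
  have XYZ_bdd: "bounded (range X)" "bounded (range Z)" "bounded (range Y)"
    by (rule bounded_subset[OF bdd(1)] bounded_subset[OF bdd(2)] bounded_subset[OF bdd(3)];
        auto simp: X_def Z_def Y_def)+
  have "weakly_tendsto (\<lambda>n. A (X n)) (A x')" by (rule weakly_tendsto_bounded_linear[OF X A])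
  moreover have "weakly_tendsto (\<lambda>n. Z n + (1 / c) *\<^sub>R dy (r n)) z'"
    using tendsto_scaleR[OF tendsto_const sub(3), of "1 / c"] by (intro weakly_tendsto_add_null Z) simp
  ultimately have feas: "z' = A x'"
    using weakly_tendsto_unique by (auto simp: X_def Z_def A_x_Suc)
  have main: "f x' + g z' \<le> f v + g w + ereal (h v - h x' + y' \<bullet> (A v - w))" for v w
  proof -
    \<comment> \<open>Two terms without a weak limit have been removed. The gradient at
      \<open>x (r n)\<close> is traded for values of \<open>h\<close> by convexity and the descent
      lemma, and \<open>Y n \<bullet> (A (X n) - Z n)\<close> becomes a multiple of
      \<open>Y n \<bullet> dy (r n)\<close>.\<close>
    define R where "R n = h v - h x' - dh x' \<bullet> (X n - x')
      + L / 2 * (norm (dx (r n)))\<^sup>2 + c * (A (v - X n) \<bullet> dz (r n))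
      + (v - X n) \<bullet> M1 (r n) (dx (r n)) + (w - Z n) \<bullet> M2 (r n) (dz (r n))
      - (1 / c) * (Y n \<bullet> dy (r n)) + (A v - w) \<bullet> Y n" for n
    have le: "f (X n) + g (Z n) \<le> f v + g w + ereal (R n)" for n
    proof -
      let ?k = "r n"
      have "h (x ?k) + (v - x ?k) \<bullet> dh (x ?k) \<le> h v" by (rule convex_on_gradient[OF h])
      moreover have "h (X n) \<le> h (x ?k) + (X n - x ?k) \<bullet> dh (x ?k) + L / 2 * (norm (dx ?k))\<^sup>2"
        unfolding X_def dx_def by (rule descent_lemma[OF h(2) L(2)])
      moreover have "h x' + (X n - x') \<bullet> dh x' \<le> h (X n)" by (rule convex_on_gradient[OF h])
      ultimately have "(v - X n) \<bullet> dh (x ?k) \<le> h v - h x' - dh x' \<bullet> (X n - x') + L / 2 * (norm (dx ?k))\<^sup>2"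
        by (simp add: inner_diff_left inner_diff_right inner_commute)
      moreover have "Y n \<bullet> A (v - X n) - Y n \<bullet> (w - Z n) = (A v - w) \<bullet> Y n - (1 / c) * (Y n \<bullet> dy ?k)"
        by (simp add: X_def Z_def A_lin A_x_Suc inner_diff_left inner_diff_right inner_add_right inner_commute)
      ultimately have "((v - X n) \<bullet> dh (x ?k) + (Y n + c *\<^sub>R dz ?k) \<bullet> A (v - X n) + (v - X n) \<bullet> M1 ?k (dx ?k))
          + (- (Y n \<bullet> (w - Z n)) + (w - Z n) \<bullet> M2 ?k (dz ?k)) \<le> R n" (is "?a + ?b \<le> _")
        unfolding R_def inner_add_left by (simp add: inner_commute)
      have "f (X n) + g (Z n) \<le> (f v + ereal ?a) + (g w + ereal ?b)"
        unfolding X_def Z_def Y_def by (intro add_mono x_subgradient z_subgradient)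
      also have "\<dots> = f v + g w + ereal (?a + ?b)"
        by (simp only: plus_ereal.simps(1)[symmetric] ac_simps)
      also have "\<dots> \<le> f v + g w + ereal (R n)"
        using \<open>?a + ?b \<le> R n\<close> by (intro add_left_mono) simp
      finally show ?thesis .
    qed
    have bound: "bounded (range (\<lambda>n. u - V n))" if "bounded (range V)" for u and V :: "nat \<Rightarrow> 'x::real_normed_vector"
    proof -
      from that obtain C where "\<And>n. norm (V n) \<le> C" by (auto simp: bounded_iff)
      then have "norm (u - V n) \<le> norm u + C" for n
        using norm_triangle_ineq4[of u "V n"] by (meson add_left_mono order_trans)
      then show ?thesis by (auto simp: bounded_iff)
    qed
    have M1_null: "(\<lambda>n. M1 (r n) (dx (r n))) \<longlonglongrightarrow> 0"
    proof (rule Lim_null_comparison)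
      show "(\<lambda>n. onorm (M1 0) * norm (dx (r n))) \<longlonglongrightarrow> 0"
        using tendsto_mult_right_zero[OF tendsto_norm_zero[OF sub(1)]] by simp
      show "eventually (\<lambda>n. norm (M1 (r n) (dx (r n))) \<le> onorm (M1 0) * norm (dx (r n))) sequentially"
        by (intro always_eventually allI op_ge_norm_le M op_ge_antimono[of M1]) simp
    qed
    have M2_null: "(\<lambda>n. M2 (r n) (dz (r n))) \<longlonglongrightarrow> 0"
    proof (rule Lim_null_comparison)
      show "(\<lambda>n. onorm (M2 0) * norm (dz (r n))) \<longlonglongrightarrow> 0"
        using tendsto_mult_right_zero[OF tendsto_norm_zero[OF sub(2)]] by simp
      show "eventually (\<lambda>n. norm (M2 (r n) (dz (r n))) \<le> onorm (M2 0) * norm (dz (r n))) sequentially"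
        by (intro always_eventually allI op_ge_norm_le M op_ge_antimono[of M2]) simp
    qed
    have "range (\<lambda>n. A (v - X n)) = A ` range (\<lambda>n. v - X n)" by auto
    then have A_bdd: "bounded (range (\<lambda>n. A (v - X n)))"
      using bounded_linear_image[OF bound[OF XYZ_bdd(1)] A] by simp
    have inner_X: "(\<lambda>n. dh x' \<bullet> (X n - x')) \<longlonglongrightarrow> dh x' \<bullet> x' - dh x' \<bullet> x'"
      unfolding inner_diff_right using X by (intro tendsto_diff tendsto_const) (simp add: weakly_tendsto_iff_inner)
    have inner_Y: "(\<lambda>n. (A v - w) \<bullet> Y n) \<longlonglongrightarrow> (A v - w) \<bullet> y'"
      using Y by (simp add: weakly_tendsto_iff_inner)
    have "R \<longlonglongrightarrow> h v - h x' - (dh x' \<bullet> x' - dh x' \<bullet> x') + L / 2 * (norm (0::'h))\<^sup>2 + c * 0 + 0 + 0 - (1 / c) * 0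
        + (A v - w) \<bullet> y'"
      unfolding R_def
      by (intro tendsto_add tendsto_diff tendsto_mult tendsto_const tendsto_power tendsto_norm
        inner_X inner_Y sub tendsto_inner_bounded_null[OF A_bdd sub(2)]
        tendsto_inner_bounded_null[OF bound[OF XYZ_bdd(1)] M1_null]
        tendsto_inner_bounded_null[OF bound[OF XYZ_bdd(2)] M2_null]
        tendsto_inner_bounded_null[OF XYZ_bdd(3) sub(3)])
    then have R: "R \<longlonglongrightarrow> h v - h x' + y' \<bullet> (A v - w)" by (simp add: inner_commute)
    show ?thesis
    proof (cases "f v = \<infinity> \<or> g w = \<infinity>")
      case True
      then show ?thesis by auto
    next
      case False
      moreover have "f v \<noteq> -\<infinity>" "g w \<noteq> -\<infinity>" using f(1) g(1) by (auto simp: proper_fun_def)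
      ultimately have fin: "\<bar>f v + g w\<bar> \<noteq> \<infinity>" by (cases "f v"; cases "g w") auto
      \<comment> \<open>Both lower limits stay above values different from
        \<open>-\<infinity>\<close>, so their sum is never indeterminate.\<close>
      have "f x' \<le> liminf (\<lambda>n. f (X n))" "g z' \<le> liminf (\<lambda>n. g (Z n))"
        by (rule weakly_sequentially_lsc[OF f(2,3) X], rule weakly_sequentially_lsc[OF g(2,3) Z])
      moreover have "f x' \<noteq> -\<infinity>" "g z' \<noteq> -\<infinity>" using f(1) g(1) by (auto simp: proper_fun_def)
      ultimately have "f x' + g z' \<le> liminf (\<lambda>n. f (X n)) + liminf (\<lambda>n. g (Z n))"
        and "\<not> ((liminf (\<lambda>n. f (X n)) = \<infinity> \<and> liminf (\<lambda>n. g (Z n)) = -\<infinity>) \<or>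
           (liminf (\<lambda>n. f (X n)) = -\<infinity> \<and> liminf (\<lambda>n. g (Z n)) = \<infinity>))"
        by (auto intro: add_mono)
      note this(1)
      also have "liminf (\<lambda>n. f (X n)) + liminf (\<lambda>n. g (Z n)) \<le> liminf (\<lambda>n. f (X n) + g (Z n))"
        by (rule ereal_liminf_add_mono) fact
      also have "\<dots> \<le> liminf (\<lambda>n. f v + g w + ereal (R n))"
        by (intro Liminf_mono always_eventually allI le)
      also have "\<dots> = f v + g w + ereal (h v - h x' + y' \<bullet> (A v - w))"
      proof (rule lim_imp_Liminf)
        obtain a where "f v + g w = ereal a" using fin by auto
        then show "(\<lambda>n. f v + g w + ereal (R n)) \<longlonglongrightarrow> f v + g w + ereal (h v - h x' + y' \<bullet> (A v - w))"
          using tendsto_add[OF tendsto_const R, of a] by (simp add: lim_ereal)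
      qed simp
      finally show ?thesis .
    qed
  qed
  \<comment> \<open>A competitor with finite values makes \<open>f x'\<close> and
    \<open>g z'\<close> finite.\<close>
  obtain v w where "f v \<noteq> \<infinity>" "g w \<noteq> \<infinity>" using f(1) g(1) by (auto simp: proper_fun_def)
  moreover have "f x' \<noteq> -\<infinity>" "g z' \<noteq> -\<infinity>" "f v \<noteq> -\<infinity>" "g w \<noteq> -\<infinity>"
    using f(1) g(1) by (auto simp: proper_fun_def)
  ultimately have "\<bar>f x'\<bar> \<noteq> \<infinity>" "\<bar>g z'\<bar> \<noteq> \<infinity>"
    using main[of v w] by (cases "f v"; cases "g w"; cases "f x'"; cases "g z'"; simp)+
  then show ?thesis using feas main by (intro saddleI)
qed

section \<open>The product metric and weak convergence of the iterates\<close>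

definition metric :: "nat \<Rightarrow> 'h \<times> 'g \<times> 'g \<Rightarrow> 'h \<times> 'g \<times> 'g" where
  "metric k p = (M1 k (fst p), M2 k (fst (snd p)) + c *\<^sub>R fst (snd p), (1 / c) *\<^sub>R snd (snd p))"

lemma sqnorm_metric:
  "sqnorm_op (metric k) (u, v, w) = sqnorm_op (M1 k) u + sqnorm_op (M2 k) v + c * (norm v)\<^sup>2 + (norm w)\<^sup>2 / c"
  by (simp add: sqnorm_op_def metric_def inner_add_right power2_norm_eq_inner)

lemma sqnorm_metric_diff:
  "sqnorm_op (metric k) ((x k, z k, y k) - (x', z', y')) = lyapunov x' z' y' k"
  by (simp add: sqnorm_metric lyapunov_def)

lemma metric_S_plus: "metric k \<in> S_plus"
proof -
  have "bounded_linear (\<lambda>p::'h \<times> 'g \<times> 'g. (M1 k (fst p), M2 k (fst (snd p)) + c *\<^sub>R fst (snd p), (1 / c) *\<^sub>R snd (snd p)))"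
    by (intro bounded_linear_Pair bounded_linear_add bounded_linear_const_scaleR bounded_linear_compose[OF S_plusD(1)[OF M(1)]]
      bounded_linear_compose[OF S_plusD(1)[OF M(2)]] bounded_linear_fst bounded_linear_snd
      bounded_linear_compose[OF bounded_linear_fst] bounded_linear_compose[OF bounded_linear_snd])
  then have "bounded_linear (metric k)" unfolding metric_def[abs_def] .
  moreover have "metric k p \<bullet> q = p \<bullet> metric k q" for p q
    using S_plusD(2)[OF M(1)] S_plusD(2)[OF M(2)]
    by (simp add: metric_def inner_prod_def inner_add_left inner_add_right)
  moreover have "0 \<le> p \<bullet> metric k p" for p
    using sqnorm_metric[of k "fst p" "fst (snd p)" "snd (snd p)"] S_plusD(3)[OF M(1)] S_plusD(3)[OF M(2)] c
    by (simp add: sqnorm_op_def)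
  ultimately show ?thesis by (simp add: S_plus_def)
qed

lemma metric_antimono: "metric k \<succcurlyeq> metric (Suc k)"
  using M(4)[of k] M(5)[of k] by (auto simp: op_ge_def sqnorm_metric add_mono)

text \<open>Common core of the three assumptions: coercivity of \<open>M1\<close> only in
  combination with \<open>A\<close>, together with \<open>dz \<longlonglongrightarrow> 0\<close>.
  What the metric does not control in \<open>x\<close> is controlled through \<open>A\<close>, hence
  through \<open>z\<close>.\<close>

lemma weak_convergence:
  assumes saddle_ex: "\<exists>p. saddle p" and "0 < \<alpha>"
    and coercive: "\<And>k u. \<alpha> * (norm u)\<^sup>2 \<le> sqnorm_op (M1 k) u - L / 2 * (norm u)\<^sup>2 + (norm (A u))\<^sup>2"
    and dz: "dz \<longlonglongrightarrow> 0"
  shows "\<exists>p. saddle p \<and> weakly_tendsto (\<lambda>k. (x k, z k, y k)) p"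
proof -
  obtain x' z' y' where s: "saddle (x', z', y')" using saddle_ex by auto
  note res = residual_limits[OF s]
  have coercive_M1: "\<alpha> * (norm u)\<^sup>2 \<le> sqnorm_op (M1 k) u + (norm (A u))\<^sup>2" for k u
  proof -
    have "0 \<le> L / 2 * (norm u)\<^sup>2" using L(1) by simp
    with coercive[of u k] show ?thesis by linarith
  qed
  have "(\<lambda>k. c *\<^sub>R ((A (x (Suc k)) - z k) - dz k)) \<longlonglongrightarrow> c *\<^sub>R (0 - 0)"
    by (intro tendsto_intros res dz)
  then have dy: "dy \<longlonglongrightarrow> 0" using c by (simp add: A_x_Suc_minus_z)
  have "(\<lambda>k. (A (x (Suc (Suc k))) - z (Suc k)) - (A (x (Suc k)) - z k) + dz k) \<longlonglongrightarrow> 0 - 0 + 0"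
    by (intro tendsto_intros res LIMSEQ_Suc[OF res(4)] dz)
  then have "(\<lambda>k. A (dx (Suc k))) \<longlonglongrightarrow> 0" by (simp add: dx_def dz_def A_lin)
  then have Adx: "(\<lambda>k. A (dx k)) \<longlonglongrightarrow> 0" by (rule LIMSEQ_imp_Suc)
  \<comment> \<open>The coercivity bound is applied to \<open>dx k\<close>: the excess of
    \<open>M1\<close> and the image under \<open>A\<close> both vanish.\<close>
  have "(\<lambda>k. (sqnorm_op (M1 k) (dx k) - L / 2 * (norm (dx k))\<^sup>2) + (norm (A (dx k)))\<^sup>2) \<longlonglongrightarrow> 0 + (norm (0::'g))\<^sup>2"
    by (intro tendsto_add tendsto_power tendsto_norm res Adx)
  then have dx: "dx \<longlonglongrightarrow> 0"
    by (intro null_if_dominated[OF \<open>0 < \<alpha>\<close> coercive]) simp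
  have "Bseq (lyapunov x' z' y')" using res(1) by (rule convergent_imp_Bseq)
  then obtain B where "\<And>k. norm (lyapunov x' z' y' k) \<le> B" unfolding Bseq_def by blast
  then have B: "lyapunov x' z' y' k \<le> B" for k using abs_le_D1 by fastforce
  have bounded_shift: "bounded (range v)" if "\<And>k. (norm (v k - p))\<^sup>2 \<le> K" for v :: "nat \<Rightarrow> 'x::real_normed_vector" and p K
  proof -
    have "norm (v k) \<le> norm p + sqrt K" for k
      using norm_triangle_ineq2[of "v k" p] real_le_rsqrt[OF that[of k]] by linarith
    then show ?thesis by (auto simp: bounded_iff)
  qed
  have parts: "sqnorm_op (M1 k) (x k - x') \<le> B" "c * (norm (z k - z'))\<^sup>2 \<le> B" "(norm (y k - y'))\<^sup>2 / c \<le> B" for k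
  proof -
    have "0 \<le> c * (norm (z k - z'))\<^sup>2" "0 \<le> (norm (y k - y'))\<^sup>2 / c" using c by auto
    with B[of k] S_plusD(3)[OF M(1), of k "x k - x'"] S_plusD(3)[OF M(2), of k "z k - z'"]
    show "sqnorm_op (M1 k) (x k - x') \<le> B" "c * (norm (z k - z'))\<^sup>2 \<le> B" "(norm (y k - y'))\<^sup>2 / c \<le> B"
      unfolding lyapunov_def by linarith+
  qed
  have z_bdd: "bounded (range z)"
    by (rule bounded_shift[of _ z' "B / c"]) (use parts(2) c in \<open>simp add: field_simps\<close>)
  have y_bdd: "bounded (range y)"
    by (rule bounded_shift[of _ y' "B * c"]) (use parts(3) c in \<open>simp add: field_simps\<close>)
  have x_bdd: "bounded (range x)"
  proof -
    \<comment> \<open>The Lyapunov function bounds only a seminorm of \<open>x k - x'\<close>.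
      Bounded \<open>z\<close> and a vanishing constraint residual bound \<open>A (x k)\<close>, and
      coercivity supplies the rest.\<close>
    have "(\<lambda>k. A (x (Suc k)) - z (Suc k)) \<longlonglongrightarrow> 0"
      using tendsto_scaleR[OF tendsto_const dy, of "1 / c"] by (simp add: A_x_Suc)
    then have "(\<lambda>k. A (x k) - z k) \<longlonglongrightarrow> 0" by (rule LIMSEQ_imp_Suc)
    then have "bounded (range (\<lambda>k. A (x k) - z k))" by (intro convergent_imp_bounded)
    from bounded_plus_comp[OF this z_bdd] have "bounded (range (\<lambda>k. A (x k)))" by simp
    then obtain C0 where "\<And>k. norm (A (x k)) \<le> C0" by (auto simp: bounded_iff)
    then have C: "norm (A (x k) - A x') \<le> C0 + norm (A x')" for k
      using norm_triangle_ineq4[of "A (x k)" "A x'"] by (meson add_right_mono order_trans)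
    define C where "C = C0 + norm (A x')"
    note C = C[folded C_def]
    have "(norm (x k - x'))\<^sup>2 \<le> (B + C\<^sup>2) / \<alpha>" for k
    proof -
      have "(norm (A (x k - x')))\<^sup>2 \<le> C\<^sup>2" using C[of k] by (simp add: A_lin power_mono)
      then have "\<alpha> * (norm (x k - x'))\<^sup>2 \<le> B + C\<^sup>2"
        using coercive_M1[of "x k - x'" k] parts(1)[of k] by linarith
      then show ?thesis using \<open>0 < \<alpha>\<close> by (simp add: field_simps)
    qed
    then show ?thesis by (rule bounded_shift)
  qed
  have "\<exists>p\<in>{p. saddle p}. weakly_tendsto (\<lambda>k. (x k, z k, y k)) p"
  proof (rule opial_variable_metric[of metric])
    show "metric k \<in> S_plus" "metric k \<succcurlyeq> metric (Suc k)" for k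
      by (rule metric_S_plus, rule metric_antimono)
    show "bounded (range (\<lambda>k. (x k, z k, y k)))"
      by (rule bounded_subset[OF bounded_Times[OF x_bdd bounded_Times[OF z_bdd y_bdd]]]) auto
    show "convergent (\<lambda>k. sqnorm_op (metric k) ((x k, z k, y k) - p))" if "p \<in> {p. saddle p}" for p
    proof -
      obtain u v w where "p = (u, v, w)" by (cases p)
      with that residual_limits(1)[of u v w] show ?thesis by (simp only: sqnorm_metric_diff mem_Collect_eq)
    qed
    show "p \<in> {p. saddle p}"
      if r: "strict_mono r" and lim: "weakly_tendsto ((\<lambda>k. (x k, z k, y k)) \<circ> r) p" for r p
    proof -
      obtain u v w where p: "p = (u, v, w)" by (cases p)
      note proj = bounded_linear_fst bounded_linear_snd
      have "weakly_tendsto (\<lambda>n. x (r n)) u"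
        using weakly_tendsto_bounded_linear[OF lim proj(1)] by (simp add: p)
      moreover have "weakly_tendsto (\<lambda>n. z (r n)) v"
        using weakly_tendsto_bounded_linear[OF lim bounded_linear_compose[OF proj]] by (simp add: p)
      moreover have "weakly_tendsto (\<lambda>n. y (r n)) w"
        using weakly_tendsto_bounded_linear[OF lim bounded_linear_compose[OF proj(2) proj(2)]] by (simp add: p)
      ultimately show ?thesis
        using cluster_point_saddle[OF dx dz dy x_bdd z_bdd y_bdd r] by (simp add: p)
    qed
    show "p = q" if pq: "p \<in> {p. saddle p}" "q \<in> {p. saddle p}"
      and lim: "(\<lambda>k. sqnorm_op (metric k) (p - q)) \<longlonglongrightarrow> 0" for p q
    proof -
      obtain u v w where d: "p - q = (u, v, w)" by (cases "p - q")
      \<comment> \<open>Feasibility of both saddle points links the components of their difference: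
        a vanishing limit metric forces \<open>v = 0\<close>, so \<open>A u = 0\<close>, and
        coercivity then needs only the \<open>M1\<close> seminorm of \<open>u\<close>.\<close>
      have "v = A u"
        using pq d saddle_feasible by (cases p; cases q) (auto simp: A_lin)
      have nonneg: "0 \<le> c * (norm v)\<^sup>2" "0 \<le> (norm w)\<^sup>2 / c" using c by auto
      have le: "sqnorm_op (M1 k) u \<le> sqnorm_op (metric k) (p - q)"
        "c * (norm v)\<^sup>2 \<le> sqnorm_op (metric k) (p - q)"
        "(norm w)\<^sup>2 / c \<le> sqnorm_op (metric k) (p - q)" for k
        unfolding d sqnorm_metric
        using S_plusD(3)[OF M(1), of k u] S_plusD(3)[OF M(2), of k v] nonneg by linarith+
      have "c * (norm v)\<^sup>2 \<le> 0" "(norm w)\<^sup>2 / c \<le> 0"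
        using le(2,3) by (auto intro: LIMSEQ_le_const[OF lim])
      then have "v = 0" "w = 0" using c by (auto simp: mult_le_0_iff divide_le_0_iff)
      then have "\<alpha> * (norm u)\<^sup>2 \<le> sqnorm_op (metric k) (p - q)" for k
        using coercive_M1[of u k] le(1)[of k] \<open>v = A u\<close> by simp
      then have "\<alpha> * (norm u)\<^sup>2 \<le> 0" by (auto intro: LIMSEQ_le_const[OF lim])
      then have "u = 0" using \<open>0 < \<alpha>\<close> by (auto simp: mult_le_0_iff)
      with \<open>v = 0\<close> \<open>w = 0\<close> d show ?thesis by (simp add: zero_prod_def[symmetric])
    qed
  qed
  then show ?thesis by blast
qed

end

section \<open>Reduction of the three assumptions to coercivity and vanishing
  \<open>dz\<close>\<close>

theorem theorem15:
  fixes f :: "'h::{real_inner, complete_space} \<Rightarrow> ereal"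
    and g :: "'g::{real_inner, complete_space} \<Rightarrow> ereal"
    and h :: "'h \<Rightarrow> real" and dh :: "'h \<Rightarrow> 'h" and L c :: real
    and A :: "'h \<Rightarrow> 'g"
    and M1 :: "nat \<Rightarrow> 'h \<Rightarrow> 'h" and M2 :: "nat \<Rightarrow> 'g \<Rightarrow> 'g"
    and x :: "nat \<Rightarrow> 'h" and z y :: "nat \<Rightarrow> 'g"
  assumes f: "proper_fun f" "convex_fun f" "lsc_fun f"
    and g: "proper_fun g" "convex_fun g" "lsc_fun g"
    and h: "convex_on UNIV h" "\<And>u. GDERIV h u :> dh u"
    and L: "0 \<le> L" "L-lipschitz_on UNIV dh"
    and A: "bounded_linear A"
    and saddle: "\<exists>p. saddle_point (Lagrangian f h g A) p"
    and c: "0 < c"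
    and M: "\<And>k. M1 k \<in> S_plus" "\<And>k. M2 k \<in> S_plus"
      "\<And>k. (\<lambda>u. M1 k u - (L / 2) *\<^sub>R u) \<in> S_plus"
      "\<And>k. M1 k \<succcurlyeq> M1 (Suc k)" "\<And>k. M2 k \<succcurlyeq> M2 (Suc k)"
    and admm: "vm_admm f g dh A c M1 M2 x z y"
    and cases:
      "(\<exists>\<alpha>1>0. \<forall>k. (\<lambda>u. M1 k u - (L / 2) *\<^sub>R u) \<in> P_alpha \<alpha>1)
       \<or> (\<exists>\<alpha>>0. \<exists>\<alpha>2>0. \<forall>k.
            (\<lambda>u. M1 k u - (L / 2) *\<^sub>R u + adjoint A (A u)) \<in> P_alpha \<alpha> \<and> M2 k \<in> P_alpha \<alpha>2)
       \<or> (\<exists>\<alpha>>0. \<forall>k.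
            (\<lambda>u. M1 k u - (L / 2) *\<^sub>R u + adjoint A (A u)) \<in> P_alpha \<alpha> \<and>
            (\<lambda>w. 2 *\<^sub>R M2 (Suc k) w) \<succcurlyeq> M2 k \<and> M2 k \<succcurlyeq> M2 (Suc k))"
  shows "\<exists>p. saddle_point (Lagrangian f h g A) p \<and> weakly_tendsto (\<lambda>k. (x k, z k, y k)) p"
proof -
  interpret vm_admm_iteration f g h dh L c A M1 M2 x z y
    using f g h L A c M admm by (rule vm_admm_iteration.intro)
  obtain x' z' y' where s: "saddle_point (Lagrangian f h g A) (x', z', y')" using saddle by auto
  have P1: "\<alpha> * (norm u)\<^sup>2 \<le> sqnorm_op (M1 k) u - L / 2 * (norm u)\<^sup>2"
    if "(\<lambda>u. M1 k u - (L / 2) *\<^sub>R u) \<in> P_alpha \<alpha>" for \<alpha> k u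
    using that by (auto simp: P_alpha_def op_ge_def sqnorm_op_def inner_diff_right power2_norm_eq_inner)
  have P1A: "\<alpha> * (norm u)\<^sup>2 \<le> sqnorm_op (M1 k) u - L / 2 * (norm u)\<^sup>2 + (norm (A u))\<^sup>2"
    if "(\<lambda>u. M1 k u - (L / 2) *\<^sub>R u + adjoint A (A u)) \<in> P_alpha \<alpha>" for \<alpha> k u
    using that by (auto simp: P_alpha_def op_ge_def sqnorm_op_def inner_diff_right inner_add_right
        power2_norm_eq_inner adjoint_works_complete[OF A])
  from cases consider
    (I) \<alpha>1 where "0 < \<alpha>1" "\<And>k. (\<lambda>u. M1 k u - (L / 2) *\<^sub>R u) \<in> P_alpha \<alpha>1"
    | (II) \<alpha> \<alpha>2 where "0 < \<alpha>" "0 < \<alpha>2"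
        "\<And>k. (\<lambda>u. M1 k u - (L / 2) *\<^sub>R u + adjoint A (A u)) \<in> P_alpha \<alpha>" "\<And>k. M2 k \<in> P_alpha \<alpha>2"
    | (III) \<alpha> where "0 < \<alpha>"
        "\<And>k. (\<lambda>u. M1 k u - (L / 2) *\<^sub>R u + adjoint A (A u)) \<in> P_alpha \<alpha>"
        "\<And>k. (\<lambda>w. 2 *\<^sub>R M2 (Suc k) w) \<succcurlyeq> M2 k"
    by blast
  then show ?thesis
  proof cases
    case I
    have "\<alpha>1 * (norm u)\<^sup>2 \<le> sqnorm_op (M1 k) u - L / 2 * (norm u)\<^sup>2 + (norm (A u))\<^sup>2" for k u
      using P1[OF I(2), of u k] zero_le_power2[of "norm (A u)"] by linarith
    from weak_convergence[OF saddle I(1) this dz_null_if_M1_coercive[OF s I(1) P1[OF I(2)]]]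
    show ?thesis .
  next
    case II
    have "\<alpha>2 * (norm u)\<^sup>2 \<le> sqnorm_op (M2 k) u" for k u
      using II(4)[of k] by (auto simp: P_alpha_def op_ge_def sqnorm_op_def power2_norm_eq_inner)
    from weak_convergence[OF saddle II(1) P1A[OF II(3)] dz_null_if_M2_coercive[OF s II(2) this]]
    show ?thesis .
  next
    case III
    have "sqnorm_op (M2 k) u \<le> 2 * sqnorm_op (M2 (Suc k)) u" for k u
      using III(3)[of k] by (simp add: op_ge_def sqnorm_op_def)
    from weak_convergence[OF saddle III(1) P1A[OF III(2)] dz_null_if_M2_halving[OF s this]]
    show ?thesis .
  qed
qed

end
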